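(* Let $\{M_n\}_{n\ge1} \subset GL(2,\mathbb{Z})$ be a sequence of expanding matrices, and let $\{D_n\}_{n\ge1}$ be a sequence of digit sets in $\mathbb{Z}^2$ of the form $$D_n=\left\{\begin{pmatrix}0\\0\end{pmatrix},\begin{pmatrix}\alpha_{n_1}\\\alpha_{n_2}\end{pmatrix},\begin{pmatrix}\beta_{n_1}\\\beta_{n_2}\end{pmatrix},\begin{pmatrix}-\alpha_{n_1}-\beta_{n_1}\\-\alpha_{n_2}-\beta_{n_2}\end{pmatrix}\right\},\qquad \alpha_{n_1}\beta_{n_2}-\alpha_{n_2}\beta_{n_1}\not\equiv 0 \pmod 2 .$$ Suppose that $|\det(M_n)|\ge4$ for all $n\ge1$, and that the sequence $\{p_n\}$ with $p_n=\alpha_{n_1}\beta_{n_2}-\alpha_{n_2}\beta_{n_1}$ is bounded. If the Moran measure $$\mu_{\{M_n\},\{D_n\}}=\delta_{M_1^{-1}D_1}*\delta_{M_1^{-1}M_2^{-1}D_2}*\cdots*\delta_{M_1^{-1}M_2^{-1}\cdots M_n^{-1}D_n}*\cdots$$ is a spectral measure, then $M_n\in GL(2,2\mathbb{Z})$ for all $n\ge2$.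
   Context: $GL(2,\mathbb{Z})$ denotes the set of $2\times2$ matrices with integer entries and nonzero determinant (not necessarily $\pm1$); $GL(2,2\mathbb{Z})$ denotes the set of those with all entries in $2\mathbb{Z}$. A real square matrix is expanding if all its eigenvalues have modulus greater than one. For a finite set $E\subset\mathbb{R}^2$, $\delta_E=\frac1{\#E}\sum_{e\in E}\delta_e$, where $\delta_e$ is the point mass at $e$; $*$ is convolution of measures. The infinite convolution denotes the weak limit (a Borel probability measure) of the finite convolutions $\delta_{M_1^{-1}D_1}*\cdots*\delta_{M_1^{-1}\cdots M_n^{-1}D_n}$ as $n\to\infty$, when it exists (its existence is part of the hypothesis that the Moran measure is a spectral measure). A Borel measure $\mu$ on $\mathbb{R}^2$ is a spectral measure if there is a countable discrete set $\Lambda\subset\mathbb{R}^2$ (a spectrum of $\mu$) such that $\{e^{2\pi i\langle\lambda,x\rangle}\}_{\lambda\in\Lambda}$ is an orthonormal basis of $L^2(\mu)$. *)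

theory Defs
  imports "HOL-Probability.Probability"
begin

section \<open>Integer matrices\<close>

text \<open>Here \<open>GL(2,\<int>)\<close> only requires a nonzero determinant, not invertibility over the integers.\<close>

definition GL2_Z :: "(int^2^2) set" where
  "GL2_Z = {A. det A \<noteq> 0}"

definition GL2_2Z :: "(int^2^2) set" where
  "GL2_2Z = {A \<in> GL2_Z. \<forall>i j. A $ i $ j \<in> range (\<lambda>k. 2 * k)}"

abbreviation real_mat :: "int^'n^'m \<Rightarrow> real^'n^'m" where
  "real_mat A \<equiv> map_matrix real_of_int A"

abbreviation real_vec :: "int^'n \<Rightarrow> real^'n" where
  "real_vec v \<equiv> (\<chi> i. real_of_int (v $ i))"

text \<open>The eigenvalues are the complex ones.\<close>

definition expanding :: "real^'n^'n \<Rightarrow> bool" where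
  "expanding A \<longleftrightarrow>
    (\<forall>c::complex. (\<exists>v. v \<noteq> 0 \<and> map_matrix complex_of_real A *v v = c *s v) \<longrightarrow> 1 < cmod c)"

section \<open>Moran measures\<close>

text \<open>\<open>distr\<close> only replaces the discrete sigma-algebra of the pmf by the Borel one.\<close>

definition unif_delta :: "'a::euclidean_space set \<Rightarrow> 'a measure" where
  "unif_delta E = distr (measure_pmf (pmf_of_set E)) borel (\<lambda>x. x)"

lemma emeasure_unif_delta:
  assumes "finite E" "E \<noteq> {}" "A \<in> sets borel"
  shows "emeasure (unif_delta E) A
       = ennreal (1 / real (card E)) * (\<Sum>e\<in>E. emeasure (return borel e) A)"
proof -
  have "emeasure (unif_delta E) A = emeasure (measure_pmf (pmf_of_set E)) A"
    using assms by (simp add: unif_delta_def emeasure_distr)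
  also have "\<dots> = ennreal (real (card (E \<inter> A)) / real (card E))"
    using assms by (simp add: emeasure_pmf_of_set)
  also have "\<dots> = ennreal (1 / real (card E)) * ennreal (real (card (E \<inter> A)))"
    by (simp flip: ennreal_mult'')
  also have "ennreal (real (card (E \<inter> A))) = (\<Sum>e\<in>E. emeasure (return borel e) A)"
    using assms by (simp add: indicator_def sum.If_cases Int_def flip: ennreal_of_nat_eq_real_of_nat)
  finally show ?thesis .
qed

text \<open>Sequences are indexed by \<open>n \<ge> 1\<close>; the entry at index \<open>0\<close> is never used. Thus
  \<open>inv_prod M n = M\<^sub>1\<inverse> \<cdots> M\<^sub>n\<inverse>\<close>.\<close>

primrec inv_prod :: "(nat \<Rightarrow> int^2^2) \<Rightarrow> nat \<Rightarrow> real^2^2" where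
  "inv_prod M 0 = mat 1"
| "inv_prod M (Suc n) = inv_prod M n ** matrix_inv (real_mat (M (Suc n)))"

definition moran_factor ::
    "(nat \<Rightarrow> int^2^2) \<Rightarrow> (nat \<Rightarrow> (int^2) set) \<Rightarrow> nat \<Rightarrow> (real^2) measure" where
  "moran_factor M D n = unif_delta ((\<lambda>d. inv_prod M n *v real_vec d) ` D n)"

text \<open>The first \<open>n\<close> factors convolved; the empty convolution is the unit, the point mass at \<open>0\<close>.\<close>

primrec moran_conv ::
    "(nat \<Rightarrow> int^2^2) \<Rightarrow> (nat \<Rightarrow> (int^2) set) \<Rightarrow> nat \<Rightarrow> (real^2) measure" where
  "moran_conv M D 0 = return borel 0"
| "moran_conv M D (Suc n) = (moran_conv M D n \<star> moran_factor M D (Suc n))"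

text \<open>The library's weak convergence of measures is confined to the real line.\<close>

definition weak_limit :: "(nat \<Rightarrow> 'a::euclidean_space measure) \<Rightarrow> 'a measure \<Rightarrow> bool" where
  "weak_limit \<mu>s \<mu> \<longleftrightarrow> prob_space \<mu> \<and> sets \<mu> = sets borel \<and>
    (\<forall>f::'a \<Rightarrow> real. continuous_on UNIV f \<and> bounded (range f) \<longrightarrow>
       (\<lambda>n. \<integral>x. f x \<partial>\<mu>s n) \<longlonglongrightarrow> (\<integral>x. f x \<partial>\<mu>))"

text \<open>A relation: \<open>\<mu>\<close> is the infinite convolution; in particular the latter exists.\<close>

definition is_moran_measure ::
    "(nat \<Rightarrow> int^2^2) \<Rightarrow> (nat \<Rightarrow> (int^2) set) \<Rightarrow> (real^2) measure \<Rightarrow> bool" where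
  "is_moran_measure M D \<mu> \<longleftrightarrow> weak_limit (moran_conv M D) \<mu>"

section \<open>Spectral measures\<close>

text \<open>\<open>L\<^sup>2(\<mu>)\<close> is represented by functions, not by classes modulo null sets. Everything below
  depends only on the classes.\<close>

definition L2_fun :: "'a measure \<Rightarrow> ('a \<Rightarrow> complex) set" where
  "L2_fun \<mu> = {f \<in> borel_measurable \<mu>. integrable \<mu> (\<lambda>x. (cmod (f x))\<^sup>2)}"

definition L2_inner :: "'a measure \<Rightarrow> ('a \<Rightarrow> complex) \<Rightarrow> ('a \<Rightarrow> complex) \<Rightarrow> complex" where
  "L2_inner \<mu> f g = (\<integral>x. f x * cnj (g x) \<partial>\<mu>)"

definition L2_nrm :: "'a measure \<Rightarrow> ('a \<Rightarrow> complex) \<Rightarrow> real" where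
  "L2_nrm \<mu> f = sqrt (\<integral>x. (cmod (f x))\<^sup>2 \<partial>\<mu>)"

text \<open>An orthonormal basis of \<open>L\<^sup>2(\<mu>)\<close> is an orthonormal family with dense linear span. Being a
  family, it cannot list the same class at two different indices.\<close>

definition L2_orthonormal_basis :: "'a measure \<Rightarrow> 'i set \<Rightarrow> ('i \<Rightarrow> 'a \<Rightarrow> complex) \<Rightarrow> bool" where
  "L2_orthonormal_basis \<mu> I e \<longleftrightarrow>
    (\<forall>i\<in>I. e i \<in> L2_fun \<mu>) \<and>
    (\<forall>i\<in>I. \<forall>j\<in>I. L2_inner \<mu> (e i) (e j) = (if i = j then 1 else 0)) \<and>
    (\<forall>f\<in>L2_fun \<mu>. \<forall>\<epsilon>>0. \<exists>F c. finite F \<and> F \<subseteq> I \<and>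
       L2_nrm \<mu> (\<lambda>x. f x - (\<Sum>i\<in>F. c i * e i x)) < \<epsilon>)"

definition char_exp :: "'a::real_inner \<Rightarrow> 'a \<Rightarrow> complex" where
  "char_exp \<xi> x = exp (2 * complex_of_real pi * \<i> * complex_of_real (\<xi> \<bullet> x))"

text \<open>The qualified name selects the topological notion (every point isolated) over the
  constructor \<open>discrete\<close> from \<open>Discrete_Topology\<close>.\<close>

definition is_spectrum :: "'a::euclidean_space measure \<Rightarrow> 'a set \<Rightarrow> bool" where
  "is_spectrum \<mu> \<Lambda> \<longleftrightarrow> countable \<Lambda> \<and> topological_space_class.discrete \<Lambda> \<and> L2_orthonormal_basis \<mu> \<Lambda> char_exp"

definition spectral_measure :: "'a::euclidean_space measure \<Rightarrow> bool" where
  "spectral_measure \<mu> \<longleftrightarrow> sets \<mu> = sets borel \<and> (\<exists>\<Lambda>. is_spectrum \<mu> \<Lambda>)"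

end

theory Submission
  imports Defs
begin

text \<open>
  The Fourier transform \<open>\<phi>\<close> of \<open>\<mu>\<close> is the infinite product of the masks
  \<open>m\<^sub>n(\<xi>) = (1 + e(s) + e(t) + e(- s - t)) / 4\<close> with \<open>e(x) = exp(2\<pi>ix)\<close>, where \<open>s\<close> and \<open>t\<close>, the phases,
  are the inner products of \<open>\<xi>\<close> with the images of \<open>\<alpha>\<^sub>n\<close> and \<open>\<beta>\<^sub>n\<close> under \<open>M\<^sub>1\<inverse>\<cdots>M\<^sub>n\<inverse>\<close>. Four unit complex
  numbers sum to zero only in opposite pairs, so \<open>m\<^sub>n\<close> vanishes exactly where \<open>2s\<close> and \<open>2t\<close> are integers
  but \<open>s\<close> and \<open>t\<close> are not both integers: on a half lattice minus the lattice. The infinite product has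
  no zeros beyond those of its factors (\<open>infinite_product_nonzero\<close>).

  Let \<open>\<Lambda>\<close> be a spectrum and fix one generic frequency \<open>\<xi>\<close>. Parseval's identity for the exponential with
  frequency \<open>- \<xi>\<close> says that the numbers \<open>|\<phi>(\<xi> + l)|\<^sup>2\<close>, \<open>l \<in> \<Lambda>\<close>, sum to \<open>1\<close>. The differences of elements of
  \<open>\<Lambda>\<close> are zeros of masks. Split off the first factor: cut \<open>\<Lambda>\<close> into blocks, the cosets of the half lattice
  of level \<open>1\<close>, and each block into four kinds, the cosets of the lattice. Choose one kind in every block.
  No difference inside such a selection is a zero of \<open>m\<^sub>1\<close>, so all of them are zeros of later masks, and
  Bessel's inequality bounds the sum of the tail weights \<open>|\<phi>/m\<^sub>1|\<^sup>2\<close> over the selection by \<open>1\<close>. On the other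
  hand \<open>|m\<^sub>1|\<^sup>2\<close> is constant on a kind, and its values on the four kinds of a block are positive and sum to
  \<open>1\<close>. Thus the Parseval sum is, block by block, an average of the four tail sums; it equals \<open>1\<close>,
  while the selection of the largest tail sum in every block gives at most \<open>1\<close>. Hence in every block the
  four tail sums coincide. Two consequences follow (\<open>selection_principle\<close>): every block contains
  all four kinds, and every selection satisfies Parseval's identity for the tail, so that the argument
  can be repeated at the next level.

  It remains to select well. Call two frequencies equivalent at level \<open>n\<close> if the coordinates of their
  difference, moved by the transpose of \<open>M\<^sub>1\<inverse>\<cdots>M\<^sub>n\<inverse>\<close>, have odd denominators. As \<open>p\<^sub>n\<close> is odd, an equivalence
  class meets each block of level \<open>n\<close> in exactly one kind, so it is a selection (\<open>tight_odd_class\<close>). But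
  at level \<open>n + 1\<close> all four kinds still occur inside this class. The transpose of \<open>M\<^sub>n\<^sub>+\<^sub>1\<close> carries the
  coordinates of level \<open>n + 1\<close>, which have even denominators for three of the four kinds, to those of level \<open>n\<close>, which
  have odd denominators; this forces every entry of \<open>M\<^sub>n\<^sub>+\<^sub>1\<close> to be even (\<open>matrix_entries_even\<close>). A preceding
  level is needed, so nothing is said about \<open>M\<^sub>1\<close>.
\<close>

section \<open>Fourier transforms and orthogonal exponentials\<close>

definition fourier :: "'a::euclidean_space measure \<Rightarrow> 'a \<Rightarrow> complex" where
  "fourier \<rho> \<xi> = (\<integral>x. char_exp \<xi> x \<partial>\<rho>)"

lemma char_exp_eq_cis: "char_exp \<xi> x = cis (2 * pi * (\<xi> \<bullet> x))"
  by (simp add: char_exp_def cis_conv_exp mult_ac)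

lemma char_exp_add_frequency: "char_exp (\<xi> + \<eta>) x = char_exp \<xi> x * char_exp \<eta> x"
  by (simp add: char_exp_eq_cis cis_mult inner_add_left distrib_left)

lemma char_exp_add_point: "char_exp \<xi> (x + y) = char_exp \<xi> x * char_exp \<xi> y"
  by (simp add: char_exp_eq_cis cis_mult inner_add_right distrib_left)

lemma cnj_char_exp: "cnj (char_exp \<xi> x) = char_exp (- \<xi>) x"
  by (simp add: char_exp_eq_cis cis_cnj)

lemma norm_char_exp [simp]: "cmod (char_exp \<xi> x) = 1"
  by (simp add: char_exp_eq_cis)

lemma char_exp_zero [simp]: "char_exp 0 x = 1" "char_exp \<xi> 0 = 1"
  by (simp_all add: char_exp_eq_cis)

lemma continuous_char_exp: "continuous_on UNIV (char_exp \<xi>)"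
  unfolding char_exp_def by (intro continuous_intros)

lemma borel_measurable_char_exp [measurable]: "char_exp \<xi> \<in> borel_measurable borel"
  by (rule borel_measurable_continuous_onI[OF continuous_char_exp])

lemma integrable_char_exp:
  assumes "prob_space \<rho>" "sets \<rho> = sets borel"
  shows "integrable \<rho> (char_exp \<xi>)"
proof -
  interpret prob_space \<rho> by fact
  have "char_exp \<xi> \<in> borel_measurable \<rho>"
    using assms(2) by (simp cong: measurable_cong_sets)
  then show ?thesis
    by (intro integrable_const_bound[where B = 1]) auto
qed

lemma fourier_zero: "prob_space \<rho> \<Longrightarrow> fourier \<rho> 0 = 1"
  by (simp add: fourier_def prob_space.prob_space)

lemma cnj_fourier: "cnj (fourier \<rho> \<xi>) = fourier \<rho> (- \<xi>)"
  unfolding fourier_def cnj_char_exp[symmetric] by simp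

text \<open>
  This is the expansion of the square, in which orthogonality leaves only the diagonal terms. It serves in two
  directions: taking the Fourier coefficients for \<open>c\<close> gives Bessel's inequality, and since other
  coefficients only increase the error, good approximations of \<open>char_exp \<eta>\<close> force near equality in it.
\<close>
lemma approximation_error_by_orthogonal_exponentials:
  fixes \<rho> :: "'a::euclidean_space measure" and c :: "'a \<Rightarrow> complex"
  assumes \<rho>: "prob_space \<rho>" "sets \<rho> = sets borel" and "finite F"
    and orth: "\<And>x y. x \<in> F \<Longrightarrow> y \<in> F \<Longrightarrow> x \<noteq> y \<Longrightarrow> fourier \<rho> (x - y) = 0"
  shows "(\<integral>x. (cmod (char_exp \<eta> x - (\<Sum>l\<in>F. c l * char_exp l x)))\<^sup>2 \<partial>\<rho>) =
    1 - (\<Sum>l\<in>F. (cmod (fourier \<rho> (\<eta> - l)))\<^sup>2) + (\<Sum>l\<in>F. (cmod (c l - fourier \<rho> (\<eta> - l)))\<^sup>2)"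
proof -
  interpret prob_space \<rho> by fact
  note [simp] = integrable_char_exp[OF \<rho>]
  define b where "b l = fourier \<rho> (\<eta> - l)" for l
  have b': "fourier \<rho> (l - \<eta>) = cnj (b l)" for l
    by (simp add: b_def cnj_fourier)
  have gram: "fourier \<rho> (x - y) = (if x = y then 1 else 0)" if "x \<in> F" "y \<in> F" for x y
    using orth[OF that] by (auto simp: fourier_zero[OF \<rho>(1)])
  have expand: "complex_of_real ((cmod (char_exp \<eta> x - (\<Sum>l\<in>F. c l * char_exp l x)))\<^sup>2) =
      1 - (\<Sum>l\<in>F. cnj (c l) * char_exp (\<eta> - l) x) - (\<Sum>l\<in>F. c l * char_exp (l - \<eta>) x)
      + (\<Sum>l\<in>F. \<Sum>\<kappa>\<in>F. c l * cnj (c \<kappa>) * char_exp (l - \<kappa>) x)" for x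
    unfolding complex_norm_square
    by (simp add: cnj_char_exp algebra_simps sum_distrib_left sum_distrib_right
        char_exp_add_frequency[symmetric] sum_product mult_ac)
       (rule sum.swap)
  have "complex_of_real (\<integral>x. (cmod (char_exp \<eta> x - (\<Sum>l\<in>F. c l * char_exp l x)))\<^sup>2 \<partial>\<rho>) =
      (\<integral>x. 1 - (\<Sum>l\<in>F. cnj (c l) * char_exp (\<eta> - l) x) - (\<Sum>l\<in>F. c l * char_exp (l - \<eta>) x)
      + (\<Sum>l\<in>F. \<Sum>\<kappa>\<in>F. c l * cnj (c \<kappa>) * char_exp (l - \<kappa>) x) \<partial>\<rho>)"
    unfolding integral_complex_of_real[symmetric] expand ..
  also have "\<dots> = 1 - (\<Sum>l\<in>F. cnj (c l) * fourier \<rho> (\<eta> - l)) - (\<Sum>l\<in>F. c l * fourier \<rho> (l - \<eta>))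
      + (\<Sum>l\<in>F. \<Sum>\<kappa>\<in>F. c l * cnj (c \<kappa>) * fourier \<rho> (l - \<kappa>))"
    by (simp add: fourier_def prob_space)
  also have "\<dots> = 1 - (\<Sum>l\<in>F. cnj (c l) * b l) - (\<Sum>l\<in>F. c l * cnj (b l)) + (\<Sum>l\<in>F. c l * cnj (c l))"
    using \<open>finite F\<close> by (simp add: gram b' b_def[symmetric] if_distrib[of "\<lambda>x. _ * x"] sum.delta cong: if_cong sum.cong)
  also have "\<dots> = complex_of_real (1 - (\<Sum>l\<in>F. (cmod (b l))\<^sup>2) + (\<Sum>l\<in>F. (cmod (c l - b l))\<^sup>2))"
    by (simp add: complex_norm_square algebra_simps sum.distrib sum_subtractf flip: of_real_power)
  finally show ?thesis
    unfolding b_def of_real_eq_iff .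
qed

lemma bessel_exponentials:
  fixes \<rho> :: "'a::euclidean_space measure"
  assumes \<rho>: "prob_space \<rho>" "sets \<rho> = sets borel" and "finite F"
    and orth: "\<And>x y. x \<in> F \<Longrightarrow> y \<in> F \<Longrightarrow> x \<noteq> y \<Longrightarrow> fourier \<rho> (x - y) = 0"
  shows "(\<Sum>l\<in>F. (cmod (fourier \<rho> (\<eta> + l)))\<^sup>2) \<le> 1"
proof -
  have "0 \<le> 1 - (\<Sum>l\<in>F. (cmod (fourier \<rho> (- \<eta> - l)))\<^sup>2)"
    using approximation_error_by_orthogonal_exponentials[OF assms, where \<eta> = "- \<eta>" and c = "\<lambda>l. fourier \<rho> (- \<eta> - l)"]
    by (smt (verit) integral_nonneg_AE[of _ \<rho>] AE_I2 zero_le_power2 norm_zero power_zero_numeral sum.neutral diff_self)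
  moreover have "cmod (fourier \<rho> (- \<eta> - l)) = cmod (fourier \<rho> (\<eta> + l))" for l
    by (metis cnj_fourier complex_mod_cnj minus_add_distrib diff_conv_add_uminus)
  ultimately show ?thesis by simp
qed

lemma norm_fourier_minus: "cmod (fourier \<rho> (- \<xi>)) = cmod (fourier \<rho> \<xi>)"
  by (metis cnj_fourier complex_mod_cnj)

lemma spectrum_imp_orthogonal:
  assumes "is_spectrum \<mu> \<Lambda>" "x \<in> \<Lambda>" "y \<in> \<Lambda>" "x \<noteq> y"
  shows "fourier \<mu> (x - y) = 0"
proof -
  have "L2_inner \<mu> (char_exp x) (char_exp y) = 0"
    using assms by (auto simp: is_spectrum_def L2_orthonormal_basis_def)
  then show ?thesis
    by (simp add: L2_inner_def cnj_char_exp fourier_def flip: char_exp_add_frequency)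
qed

text \<open>
  Only the Parseval identity of a single function, the exponential with frequency \<open>- \<xi>\<close>, is extracted from
  completeness.
\<close>
lemma spectrum_imp_parseval:
  fixes \<mu> :: "'a::euclidean_space measure"
  assumes spec: "is_spectrum \<mu> \<Lambda>" and \<mu>: "prob_space \<mu>" "sets \<mu> = sets borel"
  shows "((\<lambda>l. (cmod (fourier \<mu> (\<xi> + l)))\<^sup>2) has_sum 1) \<Lambda>"
proof -
  interpret prob_space \<mu> by fact
  let ?w = "\<lambda>l. (cmod (fourier \<mu> (\<xi> + l)))\<^sup>2"
  have le: "sum ?w F \<le> 1" if "finite F" "F \<subseteq> \<Lambda>" for F
    using that spectrum_imp_orthogonal[OF spec] by (intro bessel_exponentials \<mu>) auto
  then have summ: "?w summable_on \<Lambda>"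
    by (intro nonneg_bdd_above_summable_on bdd_aboveI2[where M = 1]) auto
  have "char_exp (- \<xi>) \<in> L2_fun \<mu>"
    using \<mu>(2) by (simp add: L2_fun_def cong: measurable_cong_sets)
  then have dense: "\<exists>F c. finite F \<and> F \<subseteq> \<Lambda> \<and>
      L2_nrm \<mu> (\<lambda>x. char_exp (- \<xi>) x - (\<Sum>l\<in>F. c l * char_exp l x)) < \<epsilon>" if "\<epsilon> > 0" for \<epsilon>
    using spec that by (auto simp: is_spectrum_def L2_orthonormal_basis_def)
  have "1 - \<epsilon> \<le> infsum ?w \<Lambda>" if "\<epsilon> > 0" for \<epsilon>
  proof -
    obtain F c where F: "finite F" "F \<subseteq> \<Lambda>"
      and lt: "L2_nrm \<mu> (\<lambda>x. char_exp (- \<xi>) x - (\<Sum>l\<in>F. c l * char_exp l x)) < sqrt \<epsilon>"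
      using dense[of "sqrt \<epsilon>"] \<open>\<epsilon> > 0\<close> by auto
    have eq: "cmod (fourier \<mu> (- \<xi> - l)) = cmod (fourier \<mu> (\<xi> + l))" for l
      using norm_fourier_minus[of \<mu> "\<xi> + l"] by simp
    have "1 - sum ?w F \<le> (\<integral>x. (cmod (char_exp (- \<xi>) x - (\<Sum>l\<in>F. c l * char_exp l x)))\<^sup>2 \<partial>\<mu>)"
      using F spectrum_imp_orthogonal[OF spec]
      by (subst approximation_error_by_orthogonal_exponentials[OF \<mu>]) (auto simp: eq intro!: sum_nonneg)
    also have "\<dots> < \<epsilon>"
      using lt by (simp add: L2_nrm_def)
    finally have "1 - \<epsilon> \<le> sum ?w F" by simp
    also have "\<dots> \<le> infsum ?w \<Lambda>"
      using F by (intro finite_sum_le_infsum summ) auto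
    finally show ?thesis .
  qed
  then have "1 \<le> infsum ?w \<Lambda>" using field_le_epsilon[of 1 "infsum ?w \<Lambda>"] by (simp add: algebra_simps)
  moreover have "infsum ?w \<Lambda> \<le> 1" using summ le by (intro infsum_le_finite_sums) auto
  ultimately show ?thesis using summ by (simp add: has_sum_iff)
qed

lemma fourier_convolution:
  fixes \<rho> \<sigma> :: "'a::ordered_euclidean_space measure"
  assumes \<rho>: "prob_space \<rho>" "sets \<rho> = sets borel" and \<sigma>: "prob_space \<sigma>" "sets \<sigma> = sets borel"
  shows "fourier (\<rho> \<star> \<sigma>) \<xi> = fourier \<rho> \<xi> * fourier \<sigma> \<xi>"
proof -
  interpret R: prob_space \<rho> by fact
  interpret S: prob_space \<sigma> by fact
  interpret P: pair_prob_space \<rho> \<sigma> ..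
  note [measurable_cong] = \<rho>(2) \<sigma>(2)
  have "fourier (\<rho> \<star> \<sigma>) \<xi> = (\<integral>z. char_exp \<xi> (fst z + snd z) \<partial>(\<rho> \<Otimes>\<^sub>M \<sigma>))"
    unfolding fourier_def convolution_def by (subst integral_distr) (auto simp: case_prod_beta)
  also have "\<dots> = (\<integral>x. \<integral>y. char_exp \<xi> (x + y) \<partial>\<sigma> \<partial>\<rho>)"
    by (subst P.integral_fst'[symmetric]) (auto intro!: P.integrable_const_bound[where B = 1])
  also have "\<dots> = fourier \<rho> \<xi> * fourier \<sigma> \<xi>"
    by (simp add: char_exp_add_point fourier_def)
  finally show ?thesis .
qed

lemma prob_space_convolution:
  fixes \<rho> \<sigma> :: "'a::ordered_euclidean_space measure"
  assumes \<rho>: "prob_space \<rho>" "sets \<rho> = sets borel" and \<sigma>: "prob_space \<sigma>" "sets \<sigma> = sets borel"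
  shows "prob_space (\<rho> \<star> \<sigma>)"
proof -
  interpret R: prob_space \<rho> by fact
  interpret S: prob_space \<sigma> by fact
  interpret P: pair_prob_space \<rho> \<sigma> ..
  note [measurable_cong] = \<rho>(2) \<sigma>(2)
  show ?thesis unfolding convolution_def by (rule P.prob_space_distr) measurable
qed

lemma fourier_unif_delta:
  assumes "finite E" "E \<noteq> {}"
  shows "fourier (unif_delta E) \<xi> = (\<Sum>e\<in>E. char_exp \<xi> e) / card E"
proof -
  have "fourier (unif_delta E) \<xi> = (\<integral>x. char_exp \<xi> x \<partial>measure_pmf (pmf_of_set E))"
    unfolding fourier_def unif_delta_def by (subst integral_distr) auto
  also have "\<dots> = (\<Sum>e\<in>E. pmf (pmf_of_set E) e *\<^sub>R char_exp \<xi> e)"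
    using assms by (intro integral_measure_pmf) (auto)
  also have "\<dots> = (\<Sum>e\<in>E. char_exp \<xi> e) / card E"
    using assms by (simp add: sum_divide_distrib scaleR_conv_of_real)
  finally show ?thesis .
qed

lemma prob_space_unif_delta: "prob_space (unif_delta E)"
  unfolding unif_delta_def by (intro measure_pmf.prob_space_distr) simp

lemma sets_unif_delta: "sets (unif_delta E) = sets borel"
  by (simp add: unif_delta_def)

lemma tendsto_fourier_weak_limit:
  assumes "weak_limit \<mu>s \<mu>" and p: "\<And>n. prob_space (\<mu>s n)" "\<And>n. sets (\<mu>s n) = sets borel"
  shows "(\<lambda>n. fourier (\<mu>s n) \<xi>) \<longlonglongrightarrow> fourier \<mu> \<xi>"
proof -
  have \<mu>: "prob_space \<mu>" "sets \<mu> = sets borel"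
    and lim: "\<And>f::_\<Rightarrow>real. continuous_on UNIV f \<Longrightarrow> bounded (range f) \<Longrightarrow>
       (\<lambda>n. \<integral>x. f x \<partial>\<mu>s n) \<longlonglongrightarrow> (\<integral>x. f x \<partial>\<mu>)"
    using assms(1) by (auto simp: weak_limit_def)
  have "(\<lambda>n. \<integral>x. Re (char_exp \<xi> x) \<partial>\<mu>s n) \<longlonglongrightarrow> (\<integral>x. Re (char_exp \<xi> x) \<partial>\<mu>)"
  proof (rule lim)
    show "bounded (range (\<lambda>x. Re (char_exp \<xi> x)))"
      by (rule boundedI[where B = 1]) (auto intro: order.trans[OF abs_Re_le_cmod])
  qed (intro continuous_intros continuous_char_exp)
  moreover have "(\<lambda>n. \<integral>x. Im (char_exp \<xi> x) \<partial>\<mu>s n) \<longlonglongrightarrow> (\<integral>x. Im (char_exp \<xi> x) \<partial>\<mu>)"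
  proof (rule lim)
    show "bounded (range (\<lambda>x. Im (char_exp \<xi> x)))"
      by (rule boundedI[where B = 1]) (auto intro: order.trans[OF abs_Im_le_cmod])
  qed (intro continuous_intros continuous_char_exp)
  ultimately show ?thesis
    using p \<mu> by (subst tendsto_complex_iff) (simp add: fourier_def integrable_char_exp)
qed

lemma isCont_fourier:
  assumes \<rho>: "prob_space \<rho>" "sets \<rho> = sets borel"
  shows "isCont (fourier \<rho>) \<xi>"
proof -
  interpret prob_space \<rho> by fact
  note [measurable_cong] = \<rho>(2)
  have "((\<lambda>\<eta>. \<integral>x. char_exp \<eta> x \<partial>\<rho>) \<longlongrightarrow> (\<integral>x. char_exp \<xi> x \<partial>\<rho>)) (at \<xi>)"
    unfolding continuous_within tendsto_at_iff_sequentially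
  proof (intro allI impI)
    fix X :: "nat \<Rightarrow> 'a" assume "X \<longlonglongrightarrow> \<xi>" 
    have *: "(\<lambda>n. char_exp (X n) x) \<longlonglongrightarrow> char_exp \<xi> x" for x
      unfolding char_exp_def by (intro tendsto_intros \<open>X \<longlonglongrightarrow> \<xi>\<close>)
    show "((\<lambda>\<eta>. \<integral>x. char_exp \<eta> x \<partial>\<rho>) \<circ> X) \<longlonglongrightarrow> (\<integral>x. char_exp \<xi> x \<partial>\<rho>)"
      unfolding o_def by (rule integral_dominated_convergence[where w = "\<lambda>_. 1"]) (use * in auto)
  qed
  then show ?thesis by (simp add: isCont_def fourier_def[abs_def])
qed

section \<open>Selecting one kind from every block\<close>

lemma infsum_over_fibres:
  fixes f :: "'a \<Rightarrow> real"
  assumes "f summable_on X"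
  shows "(\<lambda>b. infsum f {x\<in>X. g x = b}) summable_on g ` X"
    and "infsum f X = infsum (\<lambda>b. infsum f {x\<in>X. g x = b}) (g ` X)"
proof -
  let ?S = "SIGMA b:g ` X. {x\<in>X. g x = b}"
  have bij: "bij_betw snd ?S X"
    by (auto simp: bij_betw_def inj_on_def image_iff)
  have s: "(\<lambda>(b, x). f x) summable_on ?S"
    using assms summable_on_reindex_bij_betw[OF bij, of f] by (simp add: case_prod_unfold)
  show "(\<lambda>b. infsum f {x\<in>X. g x = b}) summable_on g ` X"
    by (rule summable_on_Sigma_banach[OF s])
  show "infsum f X = infsum (\<lambda>b. infsum f {x\<in>X. g x = b}) (g ` X)"
    using infsum_Sigma'_banach[OF s] infsum_reindex_bij_betw[OF bij, of f] by (simp add: case_prod_unfold)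
qed

lemma equal_if_average_attains_maximum:
  fixes u a :: "'c::finite \<Rightarrow> real"
  assumes "\<And>c. u c > 0" "(\<Sum>c\<in>UNIV. u c) = 1" "\<And>c. a c \<le> m" "(\<Sum>c\<in>UNIV. u c * a c) = m"
  shows "a c = m"
proof -
  have "(\<Sum>c\<in>UNIV. u c * (m - a c)) = (\<Sum>c\<in>UNIV. u c) * m - (\<Sum>c\<in>UNIV. u c * a c)"
    by (simp add: right_diff_distrib sum_subtractf sum_distrib_right)
  also have "\<dots> = 0" using assms by simp
  finally have "u c * (m - a c) = 0"
    using assms(1,3) by (subst (asm) sum_nonneg_eq_0_iff) (auto simp: less_imp_le)
  then show ?thesis using assms(1)[of c] by simp
qed

text \<open>
  The set \<open>X\<close> is cut into blocks and each block into finitely many kinds. The sum of \<open>w\<close> over a block is the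
  average, with weights \<open>u\<close>, of the sums of \<open>v\<close> over its kinds, hence at most the largest of these.
  Taking the best kind in every block is itself a selection, so the bound on selections squeezes the
  total \<open>1\<close>: in every block the average equals the maximum, and as the weights are positive
  all kinds have the same sum. Then every selection does as well as the best one.
\<close>
lemma selection_principle:
  fixes v w :: "'a \<Rightarrow> real" and blk :: "'a \<Rightarrow> 'b" and kind :: "'a \<Rightarrow> 'c::finite"
    and u :: "'b \<Rightarrow> 'c \<Rightarrow> real"
  assumes w: "\<And>x. x \<in> X \<Longrightarrow> w x = u (blk x) (kind x) * v x"
    and v: "\<And>x. x \<in> X \<Longrightarrow> 0 \<le> v x"
    and u: "\<And>b c. b \<in> blk ` X \<Longrightarrow> 0 < u b c" "\<And>b. b \<in> blk ` X \<Longrightarrow> (\<Sum>c\<in>UNIV. u b c) = 1"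
    and total: "(w has_sum 1) X"
    and bessel: "\<And>\<sigma> F. finite F \<Longrightarrow> F \<subseteq> {x\<in>X. kind x = \<sigma> (blk x)} \<Longrightarrow> sum v F \<le> 1"
  shows "\<And>b c d. b \<in> blk ` X \<Longrightarrow>
           infsum v {x\<in>X. blk x = b \<and> kind x = c} = infsum v {x\<in>X. blk x = b \<and> kind x = d}"
    and "\<And>\<sigma>. (v has_sum 1) {x\<in>X. kind x = \<sigma> (blk x)}"
proof -
  define a where "a b c = infsum v {x\<in>X. blk x = b \<and> kind x = c}" for b c
  define sel where "sel \<sigma> = {x\<in>X. kind x = \<sigma> (blk x)}" for \<sigma>
  have summ: "v summable_on sel \<sigma>" for \<sigma>
    using bessel[of _ \<sigma>] v unfolding sel_def
    by (intro nonneg_bdd_above_summable_on bdd_aboveI2[where M = 1]) auto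
  have sel_le: "infsum v (sel \<sigma>) \<le> 1" for \<sigma>
    using bessel[of _ \<sigma>] summ[of \<sigma>] unfolding sel_def by (intro infsum_le_finite_sums) auto
  have sel_sum: "(\<lambda>b. a b (\<sigma> b)) summable_on blk ` X"
       "infsum v (sel \<sigma>) = infsum (\<lambda>b. a b (\<sigma> b)) (blk ` X)" for \<sigma>
  proof -
    have a_sel: "a b (\<sigma> b) = infsum v {x\<in>sel \<sigma>. blk x = b}" for b
      by (auto simp: a_def sel_def intro!: arg_cong[where f = "infsum v"])
    have zero: "a b (\<sigma> b) = 0" if "b \<in> blk ` X - blk ` sel \<sigma>" for b
    proof -
      have "{x\<in>sel \<sigma>. blk x = b} = {}" using that by (force simp: image_iff)
      then show ?thesis by (simp only: a_sel infsum_empty)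
    qed
    have sub: "blk ` sel \<sigma> \<subseteq> blk ` X" by (auto simp: sel_def)
    have s: "(\<lambda>b. a b (\<sigma> b)) summable_on blk ` sel \<sigma>"
      unfolding a_sel by (rule infsum_over_fibres[OF summ])
    show "(\<lambda>b. a b (\<sigma> b)) summable_on blk ` X"
      by (rule summable_on_cong_neutral[THEN iffD1, OF _ _ _ s]) (use zero sub in auto)
    show "infsum v (sel \<sigma>) = infsum (\<lambda>b. a b (\<sigma> b)) (blk ` X)"
      unfolding infsum_over_fibres(2)[OF summ[of \<sigma>], of blk] a_sel[symmetric]
      by (rule infsum_cong_neutral) (use zero sub in auto)
  qed
  have w_sum: "w summable_on X" "infsum w X = 1"
    using total by (auto simp: summable_on_def infsumI)
  have kind_summ: "v summable_on {x\<in>X. blk x = b \<and> kind x = c}" for b c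
    by (rule summable_on_subset_banach[OF summ[of "\<lambda>_. c"]]) (auto simp: sel_def)
  have block_sum: "infsum w {x\<in>X. blk x = b} = (\<Sum>c\<in>UNIV. u b c * a b c)" for b
  proof -
    let ?B = "{x\<in>X. blk x = b}"
    have "w summable_on ?B" by (rule summable_on_subset_banach[OF w_sum(1)]) auto
    from infsum_over_fibres(2)[OF this, of kind]
    have "infsum w ?B = infsum (\<lambda>c. infsum w {x\<in>?B. kind x = c}) (kind ` ?B)" .
    also have "\<dots> = infsum (\<lambda>c. u b c * a b c) UNIV"
    proof (rule infsum_cong_neutral)
      fix c assume "c \<in> UNIV - kind ` ?B"
      then have "{x\<in>X. blk x = b \<and> kind x = c} = {}" by auto
      then show "u b c * a b c = 0" by (simp only: a_def infsum_empty mult_zero_right)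
    next
      fix c
      have "infsum w {x\<in>?B. kind x = c} = infsum (\<lambda>x. u b c * v x) {x\<in>X. blk x = b \<and> kind x = c}"
        by (rule infsum_cong_neutral) (use w in auto)
      also have "\<dots> = u b c * a b c"
        unfolding a_def by (intro infsum_cmult_right kind_summ)
      finally show "infsum w {x\<in>?B. kind x = c} = u b c * a b c" .
    qed auto
    finally show ?thesis by simp
  qed
  define top where "top b = (SOME c. \<forall>d. a b d \<le> a b c)" for b
  have top: "a b d \<le> a b (top b)" for b d
  proof -
    have "\<exists>c. \<forall>d. a b d \<le> a b c"
      using Max_in[of "range (a b)"] Max_ge[of "range (a b)"] by (fastforce simp: image_iff)
    from someI_ex[OF this] show ?thesis by (simp add: top_def)
  qed
  have avg_le: "(\<Sum>c\<in>UNIV. u b c * a b c) \<le> a b (top b)" if "b \<in> blk ` X" for b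
  proof -
    have "(\<Sum>c\<in>UNIV. u b c * a b c) \<le> (\<Sum>c\<in>UNIV. u b c * a b (top b))"
      using u(1)[OF that] top by (intro sum_mono mult_left_mono) (auto simp: less_imp_le)
    also have "\<dots> = a b (top b)"
      using u(2)[OF that] by (simp flip: sum_distrib_right)
    finally show ?thesis .
  qed
  have avg_summ: "(\<lambda>b. \<Sum>c\<in>UNIV. u b c * a b c) summable_on blk ` X"
    and avg_total: "infsum (\<lambda>b. \<Sum>c\<in>UNIV. u b c * a b c) (blk ` X) = 1"
    using infsum_over_fibres[OF w_sum(1), of blk] w_sum(2) by (simp_all add: block_sum)
  have avg_eq: "a b (top b) = (\<Sum>c\<in>UNIV. u b c * a b c)" if "b \<in> blk ` X" for b
  proof -
    let ?d = "\<lambda>b. a b (top b) - (\<Sum>c\<in>UNIV. u b c * a b c)"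
    have "(?d has_sum (infsum v (sel top) + - 1)) (blk ` X)"
      unfolding diff_conv_add_uminus
      by (intro has_sum_add has_sum_uminus[THEN iffD2])
         (use sel_sum[of top] avg_summ avg_total in \<open>auto simp: has_sum_iff\<close>)
    then have summ_d: "?d summable_on blk ` X" and "infsum ?d (blk ` X) = infsum v (sel top) - 1"
      by (simp_all add: has_sum_iff)
    then have "infsum ?d (blk ` X) \<le> 0" using sel_le[of top] by simp
    from nonneg_infsum_le_0D[OF this summ_d _ that] avg_le show ?thesis by auto
  qed
  have equal: "a b c = a b (top b)" if "b \<in> blk ` X" for b c
    using u[OF that] top avg_eq[OF that, symmetric] by (rule equal_if_average_attains_maximum)
  then show "infsum v {x\<in>X. blk x = b \<and> kind x = c} = infsum v {x\<in>X. blk x = b \<and> kind x = d}"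
    if "b \<in> blk ` X" for b c d
    using that by (metis a_def)
  show "(v has_sum 1) {x\<in>X. kind x = \<sigma> (blk x)}" for \<sigma>
  proof -
    have "infsum v (sel \<sigma>) = infsum (\<lambda>b. \<Sum>c\<in>UNIV. u b c * a b c) (blk ` X)"
      unfolding sel_sum(2) by (intro infsum_cong) (metis equal avg_eq)
    with avg_total have "infsum v (sel \<sigma>) = 1" by (rule trans[rotated])
    with has_sum_infsum[OF summ[of \<sigma>]] show ?thesis by (simp only: sel_def)
  qed
qed

section \<open>The mask of four digits\<close>

definition mask :: "real \<Rightarrow> real \<Rightarrow> complex" where
  "mask s t = (1 + cis (2 * pi * s) + cis (2 * pi * t) + cis (- (2 * pi * (s + t)))) / 4"

lemma cis_eq_1_iff_Ints: "cis (2 * pi * s) = 1 \<longleftrightarrow> s \<in> \<int>"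
proof
  assume "cis (2 * pi * s) = 1"
  then have "cos (2 * pi * s) = 1" by (metis cis.simps(1) one_complex.simps(1))
  then obtain k :: int where "2 * pi * s = of_int k * 2 * pi"
    by (auto simp: cos_one_2pi_int)
  then show "s \<in> \<int>" by simp
qed (auto elim!: Ints_cases)

lemma cis_shift_Ints: "m \<in> \<int> \<Longrightarrow> cis (2 * pi * (s + m)) = cis (2 * pi * s)"
  using cis_eq_1_iff_Ints[of m] by (simp add: distrib_left cis_mult[symmetric])

lemma cis_shift_half: "cis (2 * pi * (s + 1/2)) = - cis (2 * pi * s)"
  by (simp add: distrib_left cis_mult[symmetric])

lemma mask_alt: "mask s t = (1 + cis (2 * pi * s) + cis (2 * pi * t) + cnj (cis (2 * pi * s) * cis (2 * pi * t))) / 4"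
  by (simp add: mask_def cis_mult cis_cnj distrib_left)

lemma mask_shift_Ints: "m \<in> \<int> \<Longrightarrow> n \<in> \<int> \<Longrightarrow> mask (s + m) (t + n) = mask s t"
  by (simp add: mask_alt cis_shift_Ints)

lemma mask_Ints: "s \<in> \<int> \<Longrightarrow> t \<in> \<int> \<Longrightarrow> mask s t = 1"
  using mask_shift_Ints[of s t 0 0] by (simp add: mask_def)

lemma norm_mask_le_1: "cmod (mask s t) \<le> 1"
proof -
  have "cmod (1 + cis (2 * pi * s) + cis (2 * pi * t) + cis (- (2 * pi * (s + t)))) \<le> 1 + 1 + 1 + 1"
    by (intro norm_triangle_mono) auto
  then show ?thesis by (simp add: mask_def norm_divide)
qed

text \<open>
  If \<open>1 + x + y + z = 0\<close> for unit numbers with \<open>xyz = 1\<close>, then conjugation also gives \<open>xy + yz + zx = -1\<close>,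
  so that \<open>(1 + x)(1 + y)(1 + z) = 0\<close>: two of the four summands are opposite, hence so are the other two.
\<close>
lemma mask_eq_0_iff: "mask s t = 0 \<longleftrightarrow> 2 * s \<in> \<int> \<and> 2 * t \<in> \<int> \<and> \<not> (s \<in> \<int> \<and> t \<in> \<int>)"
proof
  define x y where "x = cis (2 * pi * s)" and "y = cis (2 * pi * t)"
  have unit: "x * cnj x = 1" "y * cnj y = 1"
    by (simp_all add: x_def y_def cis_cnj cis_mult)
  define z where "z = cnj (x * y)"
  have xyz: "x * y * z = 1"
    using unit by (simp add: z_def) algebra
  assume m: "mask s t = 0"
  then have e1: "1 + x + y + z = 0" by (simp add: mask_alt x_def y_def z_def)
  then have "cnj (1 + x + y + z) = 0" by simp
  then have e3: "1 + cnj x + cnj y + x * y = 0" by (simp add: z_def)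
  have "(1 + x) * (1 + y) * (1 + z) = 0"
  proof -
    have "x * y * (1 + cnj x + cnj y + x * y) = x * y + y + x + x * x * y * y"
      using unit by algebra
    with e3 have "x * y + y + x + x * x * y * y = 0" by simp
    moreover have "z * (x * y + y + x + x * x * y * y) = 1 + y * z + x * z + x * y"
      using xyz by algebra
    ultimately show ?thesis using xyz e1 by algebra
  qed
  then consider "x = -1" | "y = -1" | "z = -1"
    by (auto simp: add_eq_0_iff)
  then have "x * x = 1 \<and> y * y = 1"
  proof cases
    case 1
    with e1 xyz have "y * y = 1" by algebra
    with 1 show ?thesis by simp
  next
    case 2
    with e1 xyz have "x * x = 1" by algebra
    with 2 show ?thesis by simp
  next
    case 3
    with e1 xyz show ?thesis by algebra
  qed
  then have "cis (2 * pi * (2 * s)) = 1" "cis (2 * pi * (2 * t)) = 1"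
    by (simp_all add: x_def y_def cis_mult)
  then have "2 * s \<in> \<int>" "2 * t \<in> \<int>" by (simp_all only: cis_eq_1_iff_Ints)
  with m show "2 * s \<in> \<int> \<and> 2 * t \<in> \<int> \<and> \<not> (s \<in> \<int> \<and> t \<in> \<int>)" using mask_Ints[of s t] by auto
next
  assume *: "2 * s \<in> \<int> \<and> 2 * t \<in> \<int> \<and> \<not> (s \<in> \<int> \<and> t \<in> \<int>)"
  have half: "cis (2 * pi * r) = (if r \<in> \<int> then 1 else -1)" if "2 * r \<in> \<int>" for r
  proof (cases "r \<in> \<int>")
    case False
    have "cis (2 * pi * r) * cis (2 * pi * r) = 1"
      using that cis_eq_1_iff_Ints[of "2 * r"] by (simp add: cis_mult)
    then have "cis (2 * pi * r) = 1 \<or> cis (2 * pi * r) = -1"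
      by (metis square_eq_1_iff)
    with False show ?thesis by (auto simp: cis_eq_1_iff_Ints)
  qed (simp add: cis_eq_1_iff_Ints)
  show "mask s t = 0"
    using * by (auto simp: mask_alt half)
qed

text \<open>
  The argument tells whether the half integer represented modulo \<open>1\<close> is an integer, so that the pairs of
  truth values index the cosets of a lattice in its half lattice.
\<close>
definition half_shift :: "bool \<Rightarrow> real" where
  "half_shift b = (if b then 0 else 1/2)"

text \<open>
  A half shift multiplies the four summands of the mask by signs, and the four sign patterns are the characters
  of \<open>(\<int>/2)\<^sup>2\<close>. Their orthogonality, applied to four numbers of modulus \<open>1\<close>, is this identity.
\<close>
lemma sum_norm_mask_half_shifts:
  "(\<Sum>c\<in>UNIV. (cmod (mask (s + half_shift (fst c)) (t + half_shift (snd c))))\<^sup>2) = 1"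
proof -
  define x y where "x = cis (2 * pi * s)" and "y = cis (2 * pi * t)"
  have unit: "x * cnj x = 1" "y * cnj y = 1"
    by (simp_all add: x_def y_def cis_cnj cis_mult)
  have UNIV: "(UNIV :: (bool \<times> bool) set) = {(True, True), (True, False), (False, True), (False, False)}"
    by (auto simp: UNIV_bool simp flip: UNIV_Times_UNIV)
  define z where "z = cnj (x * y)"
  have z: "z * cnj z = 1" using unit by (simp add: z_def) algebra
  have "complex_of_real ((cmod (1 + x + y + z))\<^sup>2 + (cmod (1 + x - y - z))\<^sup>2
      + (cmod (1 - x + y - z))\<^sup>2 + (cmod (1 - x - y + z))\<^sup>2) = complex_of_real 16"
    unfolding of_real_add complex_norm_square complex_cnj_add complex_cnj_diff complex_cnj_one of_real_numeral
    using unit z by algebra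
  then have "(cmod (1 + x + y + z))\<^sup>2 + (cmod (1 + x - y - z))\<^sup>2
      + (cmod (1 - x + y - z))\<^sup>2 + (cmod (1 - x - y + z))\<^sup>2 = 16"
    by (simp only: of_real_eq_iff)
  then show ?thesis
    unfolding UNIV
    by (simp add: half_shift_def cis_shift_half mask_alt norm_divide power_divide z_def flip: x_def y_def)
qed

lemma norm_mask_square:
  "(cmod (mask s t))\<^sup>2 = (2 + cos (2 * pi * s) + cos (2 * pi * t) + cos (2 * pi * (s + t))
     + cos (2 * pi * (s - t)) + cos (2 * pi * (2 * s + t)) + cos (2 * pi * (s + 2 * t))) / 8"
proof -
  define a b where "a = 2 * pi * s" and "b = 2 * pi * t"
  have "(cmod (1 + cis a + cis b + cis (- (a + b))))\<^sup>2 =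
      4 + 2 * (cos a + cos b + cos (a + b) + cos (a - b) + cos (2 * a + b) + cos (a + 2 * b))"
  proof -
    have "(cmod (1 + cis a + cis b + cis (- (a + b))))\<^sup>2 =
      Re ((1 + cis a + cis b + cis (- (a + b))) * cnj (1 + cis a + cis b + cis (- (a + b))))"
      by (metis Re_complex_of_real complex_norm_square)
    also have "\<dots> = 4 + 2 * (cos a + cos b + cos (a + b) + cos (a - b) + cos (2 * a + b) + cos (a + 2 * b))"
    proof -
      have "cos (b - a) = cos (a - b)" by (metis cos_minus minus_diff_eq)
      moreover have "cos (- a - b) = cos (a + b)" by (metis cos_minus minus_add_distrib diff_conv_add_uminus)
      moreover have "cos (- (2 * a) - b) = cos (2 * a + b)" by (metis cos_minus minus_add_distrib diff_conv_add_uminus)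
      moreover have "cos (- a - b * 2) = cos (a + b * 2)" by (metis cos_minus minus_add_distrib diff_conv_add_uminus)
      moreover have "cos (- a - 2 * b) = cos (a + 2 * b)" by (metis cos_minus minus_add_distrib diff_conv_add_uminus)
      moreover have "cos (- (a * 2) - b) = cos (a * 2 + b)" by (metis cos_minus minus_add_distrib diff_conv_add_uminus)
      ultimately show ?thesis
        by (simp add: distrib_left distrib_right cis_cnj cis_mult algebra_simps)
    qed
    finally show ?thesis .
  qed
  then show ?thesis
    by (simp add: mask_def a_def b_def norm_divide power_divide algebra_simps)
qed

text \<open>
  The squared modulus of the mask is an average of cosines of linear forms, and each of them satisfies
  \<open>1 - cos 2\<theta> = 2 (1 - cos \<theta>)(1 + cos \<theta>) \<le> 4 (1 - cos \<theta>)\<close>.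
\<close>
lemma one_minus_norm_mask_square_double:
  "1 - (cmod (mask (2 * s) (2 * t)))\<^sup>2 \<le> 4 * (1 - (cmod (mask s t))\<^sup>2)"
proof -
  have c: "1 - cos (2 * pi * (2 * r)) \<le> 4 * (1 - cos (2 * pi * r))" for r
  proof -
    have "1 - cos (2 * (2 * pi * r)) = 2 * (1 - cos (2 * pi * r)) * (1 + cos (2 * pi * r))"
      unfolding cos_double_cos[of "2 * pi * r"] by (simp add: power2_eq_square algebra_simps)
    also have "\<dots> \<le> 2 * (1 - cos (2 * pi * r)) * 2"
      by (intro mult_left_mono) auto
    finally show ?thesis by (simp add: mult_ac)
  qed
  show ?thesis
    using c[of s] c[of t] c[of "s + t"] c[of "s - t"] c[of "2 * s + t"] c[of "s + 2 * t"]
    by (simp add: norm_mask_square algebra_simps add_divide_distrib)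
qed

lemma half_integer_cases:
  fixes x :: real
  assumes "2 * x \<in> \<int>"
  shows "x - half_shift (x \<in> \<int>) \<in> \<int>"
proof -
  obtain z :: int where z: "2 * x = of_int z" using assms by (auto elim: Ints_cases)
  show ?thesis
  proof (cases "even z")
    case True
    then obtain w where "z = 2 * w" by (rule evenE)
    with z have "x = of_int w" by simp
    then show ?thesis by (simp add: half_shift_def)
  next
    case False
    then obtain w where "z = 2 * w + 1" by (rule oddE)
    with z have "x - 1/2 = of_int w" by simp
    then have "x - 1/2 \<in> \<int>" by simp
    then show ?thesis by (simp add: half_shift_def)
  qed
qed

lemma half_integer_parity_eq_iff:
  fixes x y :: real
  assumes "2 * x \<in> \<int>" "2 * y \<in> \<int>"
  shows "(x \<in> \<int> \<longleftrightarrow> y \<in> \<int>) \<longleftrightarrow> x - y \<in> \<int>"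
proof
  assume "x \<in> \<int> \<longleftrightarrow> y \<in> \<int>"
  then have "x - y = (x - half_shift (x \<in> \<int>)) - (y - half_shift (y \<in> \<int>))" by simp
  also have "\<dots> \<in> \<int>" using assms by (intro Ints_diff half_integer_cases)
  finally show "x - y \<in> \<int>" .
next
  assume d: "x - y \<in> \<int>"
  show "x \<in> \<int> \<longleftrightarrow> y \<in> \<int>"
    using Ints_diff[OF _ d, of x] Ints_add[OF d, of y] by auto
qed

section \<open>Odd denominators\<close>

text \<open>
  The rational numbers with odd denominator, that is the localization of the integers at \<open>2\<close>: odd numbers become
  units, so that odd determinants can be inverted, while parity keeps its meaning.
\<close>
definition odd_frac :: "real set" where
  "odd_frac = {x. \<exists>k::int. odd k \<and> of_int k * x \<in> \<int>}"

lemma Ints_odd_frac: "x \<in> \<int> \<Longrightarrow> x \<in> odd_frac"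
  unfolding odd_frac_def by (auto intro!: exI[of _ 1])

lemma odd_frac_add: "x \<in> odd_frac \<Longrightarrow> y \<in> odd_frac \<Longrightarrow> x + y \<in> odd_frac"
proof -
  assume "x \<in> odd_frac" "y \<in> odd_frac"
  then obtain k l :: int where "odd k" "of_int k * x \<in> \<int>" "odd l" "of_int l * y \<in> \<int>"
    by (auto simp: odd_frac_def)
  then have "odd (k * l)" "of_int l * (of_int k * x) + of_int k * (of_int l * y) \<in> \<int>"
    by auto
  then show ?thesis
    unfolding odd_frac_def by (auto intro!: exI[of _ "k * l"] simp: algebra_simps)
qed

lemma odd_frac_mult: "x \<in> odd_frac \<Longrightarrow> y \<in> odd_frac \<Longrightarrow> x * y \<in> odd_frac"
proof -
  assume "x \<in> odd_frac" "y \<in> odd_frac"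
  then obtain k l :: int where "odd k" "of_int k * x \<in> \<int>" "odd l" "of_int l * y \<in> \<int>"
    by (auto simp: odd_frac_def)
  then have "odd (k * l)" "(of_int k * x) * (of_int l * y) \<in> \<int>"
    by auto
  then show ?thesis
    unfolding odd_frac_def by (auto intro!: exI[of _ "k * l"] simp: algebra_simps)
qed

lemma odd_frac_diff: "x \<in> odd_frac \<Longrightarrow> y \<in> odd_frac \<Longrightarrow> x - y \<in> odd_frac"
  using odd_frac_add[of x "-1 * y"] odd_frac_mult[of "-1" y] Ints_odd_frac[of "-1"] by simp

lemma odd_frac_cancel_odd: "odd k \<Longrightarrow> of_int k * x \<in> odd_frac \<Longrightarrow> x \<in> odd_frac"
proof -
  assume k: "odd k" and "of_int k * x \<in> odd_frac"
  then obtain l :: int where l: "odd l" "of_int l * (of_int k * x) \<in> \<int>"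
    by (auto simp: odd_frac_def)
  then have "odd (l * k)" "of_int (l * k) * x \<in> \<int>"
    using k by (simp_all add: mult.assoc)
  then show ?thesis unfolding odd_frac_def by blast
qed

lemma half_odd_frac_of_int: "of_int z / 2 \<in> odd_frac \<longleftrightarrow> even z"
proof
  assume "of_int z / 2 \<in> odd_frac"
  then obtain k n :: int where "odd k" "of_int k * (of_int z / 2) = (of_int n :: real)"
    by (auto simp: odd_frac_def elim!: Ints_cases)
  then have "of_int (k * z) = (of_int (2 * n) :: real)" by simp
  then have "k * z = 2 * n" by (simp only: of_int_eq_iff)
  then show "even z" using \<open>odd k\<close> by (metis dvd_triv_left even_mult_iff)
next
  assume "even z"
  then obtain w where "z = 2 * w" by (rule evenE)
  then show "of_int z / 2 \<in> odd_frac" by (simp add: Ints_odd_frac)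
qed

lemma Ints_if_odd_frac:
  assumes "x \<in> odd_frac" "2 * x \<in> \<int>"
  shows "x \<in> \<int>"
proof -
  obtain z :: int where z: "2 * x = of_int z" using assms(2) by (auto elim: Ints_cases)
  then have x: "x = of_int z / 2" by simp
  from assms(1) have "even z" unfolding x half_odd_frac_of_int .
  then show ?thesis unfolding x by (auto elim!: evenE)
qed

text \<open>Writing \<open>2 x = n / k\<close> with odd \<open>k\<close>, the parity of \<open>n\<close> decides which shift is needed.\<close>
lemma ex_half_shift_odd_frac:
  assumes "2 * x \<in> odd_frac"
  shows "\<exists>b. x - half_shift b \<in> odd_frac"
proof -
  obtain k n :: int where k: "odd k" "of_int k * (2 * x) = of_int n"
    using assms by (auto simp: odd_frac_def elim!: Ints_cases)
  have "of_int k * (x - half_shift (even n)) \<in> odd_frac"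
  proof -
    have "of_int k * (x - half_shift (even n)) = of_int (if even n then n else n - k) / 2"
      using k(2) by (auto simp: half_shift_def algebra_simps)
    then show ?thesis using k(1) by (simp only: half_odd_frac_of_int) auto
  qed
  then show ?thesis using odd_frac_cancel_odd[OF k(1)] by blast
qed

section \<open>The phases of a digit system\<close>

lemma matrix_inv_inverse:
  assumes "invertible A"
  shows matrix_mul_inv_right: "A ** matrix_inv A = mat 1"
    and matrix_mul_inv_left: "matrix_inv A ** A = mat 1"
  using someI_ex[OF assms[unfolded invertible_def]] by (auto simp: matrix_inv_def)

lemma real_mat_invertible:
  fixes A :: "int^2^2"
  assumes "det A \<noteq> 0"
  shows "invertible (real_mat A)"
proof -
  have "det (real_mat A) = of_int (det A)"
    by (simp add: det_2 map_matrix_def)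
  then show ?thesis using assms by (simp add: invertible_det_nz)
qed

text \<open>
  The convolution of the factors \<open>K + 1, \<dots>, K + j\<close>. Its Fourier transform is a partial product of masks, so that
  Bessel's inequality is available for the tails of the product.
\<close>
primrec conv_from :: "(nat \<Rightarrow> int^2^2) \<Rightarrow> (nat \<Rightarrow> (int^2) set) \<Rightarrow> nat \<Rightarrow> nat \<Rightarrow> (real^2) measure" where
  "conv_from M D K 0 = return borel 0"
| "conv_from M D K (Suc j) = (conv_from M D K j \<star> moran_factor M D (K + Suc j))"

lemma prob_space_moran_factor: "prob_space (moran_factor M D n)"
  and sets_moran_factor: "sets (moran_factor M D n) = sets borel"
  by (simp_all add: moran_factor_def prob_space_unif_delta sets_unif_delta)

lemma moran_conv_eq_conv_from: "moran_conv M D n = conv_from M D 0 n"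
  by (induction n) simp_all

lemma sets_conv_from: "sets (conv_from M D K j) = sets borel"
  by (cases j) simp_all

lemma prob_space_conv_from: "prob_space (conv_from M D K j)"
proof (induction j)
  case 0
  show ?case by (simp add: prob_space_return)
next
  case (Suc j)
  then show ?case
    by (simp add: prob_space_convolution sets_conv_from prob_space_moran_factor sets_moran_factor)
qed

locale digit_system =
  fixes M :: "nat \<Rightarrow> int^2^2" and \<alpha> \<beta> :: "nat \<Rightarrow> int^2"
  assumes det_M: "n \<ge> 1 \<Longrightarrow> det (M n) \<noteq> 0"
    and odd_det: "n \<ge> 1 \<Longrightarrow> odd (\<alpha> n $ 1 * \<beta> n $ 2 - \<alpha> n $ 2 * \<beta> n $ 1)"
begin

definition digits :: "nat \<Rightarrow> (int^2) set" where
  "digits n = {0, \<alpha> n, \<beta> n, - \<alpha> n - \<beta> n}"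

text \<open>The frequency in the coordinates in which the digits of level \<open>n\<close> are integer vectors.\<close>
definition dual :: "nat \<Rightarrow> real^2 \<Rightarrow> real^2" where
  "dual n \<xi> = transpose (inv_prod M n) *v \<xi>"

definition phase1 :: "nat \<Rightarrow> real^2 \<Rightarrow> real" where
  "phase1 n \<xi> = real_vec (\<alpha> n) \<bullet> dual n \<xi>"

definition phase2 :: "nat \<Rightarrow> real^2 \<Rightarrow> real" where
  "phase2 n \<xi> = real_vec (\<beta> n) \<bullet> dual n \<xi>"

definition level_mask :: "nat \<Rightarrow> real^2 \<Rightarrow> complex" where
  "level_mask n \<xi> = mask (phase1 n \<xi>) (phase2 n \<xi>)"

definition in_half_lattice :: "nat \<Rightarrow> real^2 \<Rightarrow> bool" where
  "in_half_lattice n \<xi> \<longleftrightarrow> 2 * phase1 n \<xi> \<in> \<int> \<and> 2 * phase2 n \<xi> \<in> \<int>"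

definition odd_dual :: "nat \<Rightarrow> real^2 \<Rightarrow> bool" where
  "odd_dual n \<xi> \<longleftrightarrow> (\<forall>i. dual n \<xi> $ i \<in> odd_frac)"

lemma dual_add: "dual n (\<xi> + \<eta>) = dual n \<xi> + dual n \<eta>"
  by (simp add: dual_def matrix_vector_right_distrib)

lemma dual_diff: "dual n (\<xi> - \<eta>) = dual n \<xi> - dual n \<eta>"
  by (simp add: dual_def matrix_vector_mult_diff_distrib)

lemma dual_scale: "dual n (c *\<^sub>R \<xi>) = c *\<^sub>R dual n \<xi>"
  by (simp add: dual_def matrix_vector_mult_scaleR)

lemma phase_add: "phase1 n (\<xi> + \<eta>) = phase1 n \<xi> + phase1 n \<eta>"
    "phase2 n (\<xi> + \<eta>) = phase2 n \<xi> + phase2 n \<eta>"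
  by (simp_all add: phase1_def phase2_def dual_add inner_add_right)

lemma phase_diff: "phase1 n (\<xi> - \<eta>) = phase1 n \<xi> - phase1 n \<eta>"
    "phase2 n (\<xi> - \<eta>) = phase2 n \<xi> - phase2 n \<eta>"
  by (simp_all add: phase1_def phase2_def dual_diff inner_diff_right)

lemma phase_scale: "phase1 n (c *\<^sub>R \<xi>) = c * phase1 n \<xi>"
    "phase2 n (c *\<^sub>R \<xi>) = c * phase2 n \<xi>"
  by (simp_all add: phase1_def phase2_def dual_scale)

lemma phase_coords:
  "phase1 n \<xi> = of_int (\<alpha> n $ 1) * dual n \<xi> $ 1 + of_int (\<alpha> n $ 2) * dual n \<xi> $ 2"
  "phase2 n \<xi> = of_int (\<beta> n $ 1) * dual n \<xi> $ 1 + of_int (\<beta> n $ 2) * dual n \<xi> $ 2"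
  by (simp_all add: phase1_def phase2_def inner_vec_def sum_2)

text \<open>Cramer's rule for the passage from coordinates to phases, whose determinant \<open>p\<^sub>n\<close> is odd.\<close>
lemma dual_of_phase:
  "of_int (\<alpha> n $ 1 * \<beta> n $ 2 - \<alpha> n $ 2 * \<beta> n $ 1) * dual n \<xi> $ 1 =
     of_int (\<beta> n $ 2) * phase1 n \<xi> - of_int (\<alpha> n $ 2) * phase2 n \<xi>"
  "of_int (\<alpha> n $ 1 * \<beta> n $ 2 - \<alpha> n $ 2 * \<beta> n $ 1) * dual n \<xi> $ 2 =
     of_int (\<alpha> n $ 1) * phase2 n \<xi> - of_int (\<beta> n $ 1) * phase1 n \<xi>"
  by (simp_all add: phase_coords algebra_simps)

lemma odd_dual_iff_phase:
  assumes "n \<ge> 1"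
  shows "odd_dual n \<xi> \<longleftrightarrow> phase1 n \<xi> \<in> odd_frac \<and> phase2 n \<xi> \<in> odd_frac"
proof
  assume "odd_dual n \<xi>"
  then show "phase1 n \<xi> \<in> odd_frac \<and> phase2 n \<xi> \<in> odd_frac"
    by (auto simp: odd_dual_def phase_coords intro!: odd_frac_add odd_frac_mult intro: Ints_odd_frac)
next
  assume *: "phase1 n \<xi> \<in> odd_frac \<and> phase2 n \<xi> \<in> odd_frac"
  have "dual n \<xi> $ 1 \<in> odd_frac" "dual n \<xi> $ 2 \<in> odd_frac"
    by (rule odd_frac_cancel_odd[OF odd_det[OF assms]], unfold dual_of_phase,
        use * in \<open>auto intro!: odd_frac_diff odd_frac_mult intro: Ints_odd_frac\<close>)+
  then show "odd_dual n \<xi>" by (auto simp: odd_dual_def forall_2)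
qed

lemma invertible_inv_prod: "invertible (inv_prod M n)"
proof (induction n)
  case (Suc n)
  have "invertible (real_mat (M (Suc n)))"
    by (intro real_mat_invertible det_M) simp
  then have "invertible (matrix_inv (real_mat (M (Suc n))))"
    using matrix_mul_inv_left matrix_mul_inv_right unfolding invertible_def[of "matrix_inv _"] by blast
  with Suc show ?case by (simp add: invertible_mult)
qed (auto simp: invertible_def intro!: exI[where x = "mat 1"])

lemma dual_Suc: "dual n \<xi> = transpose (real_mat (M (Suc n))) *v dual (Suc n) \<xi>"
proof -
  let ?R = "real_mat (M (Suc n))"
  have "invertible ?R" by (intro real_mat_invertible det_M) simp
  then have "transpose ?R ** transpose (matrix_inv ?R) = mat 1"
    by (simp only: matrix_transpose_mul[symmetric] matrix_mul_inv_left transpose_mat)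
  then have "dual n \<xi> = (transpose ?R ** transpose (matrix_inv ?R)) *v (transpose (inv_prod M n) *v \<xi>)"
    by (simp only: dual_def matrix_vector_mul_lid)
  also have "\<dots> = transpose ?R *v dual (Suc n) \<xi>"
    by (simp only: dual_def inv_prod.simps matrix_transpose_mul matrix_vector_mul_assoc[symmetric])
  finally show ?thesis .
qed

lemma dual_Suc_coord:
  "dual n \<xi> $ i = of_int (M (Suc n) $ 1 $ i) * dual (Suc n) \<xi> $ 1 + of_int (M (Suc n) $ 2 $ i) * dual (Suc n) \<xi> $ 2"
  by (subst dual_Suc) (simp add: matrix_vector_mult_def transpose_def map_matrix_def sum_2)

lemma odd_dual_Suc_imp: "odd_dual (Suc n) \<xi> \<Longrightarrow> odd_dual n \<xi>"
  by (auto simp: odd_dual_def dual_Suc_coord[of n] intro!: odd_frac_add odd_frac_mult intro: Ints_odd_frac)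

text \<open>
  The coordinates of level \<open>n\<close> arise from those of level \<open>n + 1\<close> by the integer matrix \<open>M\<^sub>n\<^sub>+\<^sub>1\<^sup>T\<close>, which keeps odd
  denominators.
\<close>
lemma odd_dual_mono: "n \<le> m \<Longrightarrow> odd_dual m \<xi> \<Longrightarrow> odd_dual n \<xi>"
  by (induction rule: dec_induct) (auto intro: odd_dual_Suc_imp)

lemma odd_dual_add: "odd_dual n \<xi> \<Longrightarrow> odd_dual n \<eta> \<Longrightarrow> odd_dual n (\<xi> + \<eta>)"
  by (auto simp: odd_dual_def dual_add intro!: odd_frac_add)

lemma odd_dual_diff: "odd_dual n \<xi> \<Longrightarrow> odd_dual n \<eta> \<Longrightarrow> odd_dual n (\<xi> - \<eta>)"
  by (auto simp: odd_dual_def dual_diff intro!: odd_frac_diff)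

lemma phase_injective:
  assumes "n \<ge> 1" "phase1 n \<xi> = phase1 n \<eta>" "phase2 n \<xi> = phase2 n \<eta>"
  shows "\<xi> = \<eta>"
proof -
  have p: "of_int (\<alpha> n $ 1 * \<beta> n $ 2 - \<alpha> n $ 2 * \<beta> n $ 1) \<noteq> (0::real)"
    using odd_det[OF assms(1)] by (metis even_zero of_int_eq_0_iff)
  have "dual n \<xi> $ 1 = dual n \<eta> $ 1" "dual n \<xi> $ 2 = dual n \<eta> $ 2"
    by (rule mult_left_cancel[OF p, THEN iffD1], unfold dual_of_phase, simp add: assms)+
  then have "dual n \<xi> = dual n \<eta>" by (simp add: vec_eq_iff forall_2)
  moreover have "invertible (transpose (inv_prod M n))"
    using invertible_inv_prod by (simp add: transpose_invertible)
  ultimately show ?thesis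
    unfolding dual_def by (metis injD inj_matrix_vector_mult)
qed

lemma level_mask_eq_0_iff:
  "level_mask n \<xi> = 0 \<longleftrightarrow> in_half_lattice n \<xi> \<and> \<not> (phase1 n \<xi> \<in> \<int> \<and> phase2 n \<xi> \<in> \<int>)"
  by (auto simp: level_mask_def mask_eq_0_iff in_half_lattice_def)

text \<open>
  A zero of a mask at any later level is, up to the factor \<open>2\<close>, integral at that level and thus has odd denominators
  at all earlier levels. Applied to the differences within a spectrum, this makes all half lattices comparable at a
  single level.
\<close>
lemma level_mask_zero_imp_odd_dual:
  assumes "n \<ge> 1" "level_mask n \<xi> = 0" "m \<le> n"
  shows "odd_dual m (2 *\<^sub>R \<xi>)"
  using assms by (intro odd_dual_mono[OF assms(3)])
    (auto simp: level_mask_eq_0_iff in_half_lattice_def odd_dual_iff_phase phase_scale intro: Ints_odd_frac)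

lemma countable_half_lattice:
  assumes "n \<ge> 1"
  shows "countable {\<xi>. in_half_lattice n \<xi>}"
proof -
  let ?f = "\<lambda>\<xi>. (2 * phase1 n \<xi>, 2 * phase2 n \<xi>)"
  have "inj_on ?f {\<xi>. in_half_lattice n \<xi>}"
    using phase_injective[OF assms] by (auto simp: inj_on_def)
  moreover have "countable (?f ` {\<xi>. in_half_lattice n \<xi>})"
  proof (rule countable_subset)
    show "?f ` {\<xi>. in_half_lattice n \<xi>} \<subseteq> \<int> \<times> \<int>" by (auto simp: in_half_lattice_def)
    show "countable (\<int> \<times> \<int> :: (real \<times> real) set)" by (intro countable_SIGMA countable_int)
  qed
  ultimately show ?thesis using countable_image_inj_on by blast
qed

text \<open>
  Half lattices are countable, so only countably many \<open>\<xi>\<close> are excluded. At the others every mask is nonzero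
  at \<open>\<xi> + l\<close>, and also where the phases differ from those of \<open>\<xi> + l\<close> by half shifts.
\<close>
lemma ex_generic_shift:
  assumes "countable \<Lambda>"
  shows "\<exists>\<xi>. \<forall>l\<in>\<Lambda>. \<forall>n\<ge>1. \<not> in_half_lattice n (\<xi> + l)"
proof -
  define bad where "bad = (\<Union>l\<in>\<Lambda>. \<Union>n\<in>{1..}. (\<lambda>\<xi>. \<xi> - l) ` {\<xi>. in_half_lattice n \<xi>})"
  have "countable bad"
    unfolding bad_def by (intro countable_UN assms countable_image countable_half_lattice) auto
  moreover have "uncountable (UNIV :: (real^2) set)"
    using uncountable_ball[of 1 "0 :: real^2"] countable_subset[OF subset_UNIV] by auto
  ultimately have "bad \<noteq> UNIV" by auto
  then obtain \<xi> where \<xi>: "\<xi> \<notin> bad" by auto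
  have "\<not> in_half_lattice n (\<xi> + l)" if "l \<in> \<Lambda>" "n \<ge> 1" for l n
  proof
    assume "in_half_lattice n (\<xi> + l)"
    then have "(\<xi> + l) - l \<in> bad"
      unfolding bad_def using that by (intro UN_I[of l] UN_I[of n] imageI) auto
    with \<xi> show False by simp
  qed
  then show ?thesis by blast
qed

lemma in_half_lattice_diff: "in_half_lattice n x \<Longrightarrow> in_half_lattice n y \<Longrightarrow> in_half_lattice n (x - y)"
  by (simp add: in_half_lattice_def phase_diff right_diff_distrib)

lemma in_half_lattice_add: "in_half_lattice n x \<Longrightarrow> in_half_lattice n y \<Longrightarrow> in_half_lattice n (x + y)"
  by (simp add: in_half_lattice_def phase_add distrib_left)

lemma in_half_lattice_zero: "in_half_lattice n 0"
  using phase_diff[of n 0 0] by (simp add: in_half_lattice_def)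

lemma in_half_lattice_commute: "in_half_lattice n (x - y) \<Longrightarrow> in_half_lattice n (y - x)"
  using in_half_lattice_diff[OF in_half_lattice_zero, of n "x - y"] by simp

lemma in_half_lattice_trans:
  "in_half_lattice n (x - y) \<Longrightarrow> in_half_lattice n (y - z) \<Longrightarrow> in_half_lattice n (x - z)"
  using in_half_lattice_add[of n "x - y" "y - z"] by simp

section \<open>The infinite product of masks\<close>

lemma distinct_digits:
  assumes "n \<ge> 1"
  shows "distinct [0, \<alpha> n, \<beta> n, - \<alpha> n - \<beta> n]"
proof -
  let ?p = "\<lambda>a b :: int^2. a $ 1 * b $ 2 - a $ 2 * b $ 1"
  have odd: "odd (?p (\<alpha> n) (\<beta> n))" using odd_det[OF assms] .
  have "0 \<noteq> \<alpha> n" "0 \<noteq> \<beta> n" "\<alpha> n \<noteq> \<beta> n"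
    using odd by auto
  moreover have "0 \<noteq> - \<alpha> n - \<beta> n"
  proof
    assume "0 = - \<alpha> n - \<beta> n"
    then have "\<beta> n = - \<alpha> n" by (simp add: eq_neg_iff_add_eq_0 add.commute)
    with odd show False by simp
  qed
  moreover have "\<alpha> n \<noteq> - \<alpha> n - \<beta> n"
  proof
    assume "\<alpha> n = - \<alpha> n - \<beta> n"
    then have "\<alpha> n + \<alpha> n + \<beta> n = 0" by simp
    then have "\<beta> n = - (\<alpha> n + \<alpha> n)" by (simp only: add_eq_0_iff)
    with odd show False by (simp add: algebra_simps)
  qed
  moreover have "\<beta> n \<noteq> - \<alpha> n - \<beta> n"
  proof
    assume "\<beta> n = - \<alpha> n - \<beta> n"
    then have "\<beta> n + \<beta> n + \<alpha> n = 0" by simp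
    then have "\<alpha> n = - (\<beta> n + \<beta> n)" by (simp only: add_eq_0_iff)
    with odd show False by (simp add: algebra_simps)
  qed
  ultimately show ?thesis by (simp only: distinct.simps list.set) blast
qed

lemma inner_inv_prod: "\<xi> \<bullet> (inv_prod M n *v x) = x \<bullet> dual n \<xi>"
  unfolding dual_def transpose_matrix_vector dot_lmul_matrix[symmetric] by (rule inner_commute)

lemma fourier_moran_factor:
  assumes "n \<ge> 1" "D n = digits n"
  shows "fourier (moran_factor M D n) \<xi> = level_mask n \<xi>"
proof -
  let ?g = "\<lambda>d. inv_prod M n *v real_vec d"
  have inj: "inj_on ?g (digits n)"
  proof (rule inj_onI)
    fix d e assume "?g d = ?g e"
    then have "real_vec d = real_vec e"
      by (rule injD[OF inj_matrix_vector_mult[OF invertible_inv_prod]])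
    then show "d = e" by (simp add: vec_eq_iff)
  qed
  have card: "card (digits n) = 4"
    using distinct_card[OF distinct_digits[OF assms(1)]] by (simp add: digits_def)
  have ce: "char_exp \<xi> (?g d) = cis (2 * pi * (real_vec d \<bullet> dual n \<xi>))" for d
    unfolding char_exp_eq_cis inner_inv_prod ..
  have neg: "real_vec (- \<alpha> n - \<beta> n) \<bullet> dual n \<xi> = - (phase1 n \<xi> + phase2 n \<xi>)"
    by (simp add: phase_coords inner_vec_def sum_2 algebra_simps)
  have zero: "real_vec 0 \<bullet> dual n \<xi> = 0" by (simp add: inner_vec_def)
  have fin: "finite (digits n)" "digits n \<noteq> {}" by (simp_all add: digits_def)
  have "fourier (moran_factor M D n) \<xi> = (\<Sum>d\<in>digits n. char_exp \<xi> (?g d)) / 4"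
    unfolding moran_factor_def assms(2)
    using fin by (subst fourier_unif_delta) (auto simp only: finite_imageI image_is_empty
      sum.reindex[OF inj] card_image[OF inj] card o_def of_nat_numeral)
  also have "(\<Sum>d\<in>digits n. char_exp \<xi> (?g d)) = (\<Sum>d\<leftarrow>[0, \<alpha> n, \<beta> n, - \<alpha> n - \<beta> n]. char_exp \<xi> (?g d))"
    using sum.distinct_set_conv_list[OF distinct_digits[OF assms(1)], of "\<lambda>d. char_exp \<xi> (?g d)"]
    by (simp only: digits_def list.set)
  also have "\<dots> = 1 + cis (2 * pi * phase1 n \<xi>) + cis (2 * pi * phase2 n \<xi>) + cis (2 * pi * - (phase1 n \<xi> + phase2 n \<xi>))"
    unfolding ce list.map sum_list.Cons sum_list.Nil neg zero phase1_def[symmetric] phase2_def[symmetric]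
    by (simp only: mult_zero_right cis_zero add_0_right add.assoc)
  also have "\<dots> / 4 = level_mask n \<xi>"
    by (simp only: level_mask_def mask_def mult_minus_right)
  finally show ?thesis .
qed

lemma fourier_conv_from:
  assumes "\<And>n. n \<ge> 1 \<Longrightarrow> D n = digits n"
  shows "fourier (conv_from M D K j) \<xi> = (\<Prod>m\<in>{K<..K + j}. level_mask m \<xi>)"
proof (induction j)
  case 0
  have "fourier (return borel 0) \<xi> = char_exp \<xi> 0"
    unfolding fourier_def by (subst integral_return) auto
  then show ?case by simp
next
  case (Suc j)
  have "{K<..K + Suc j} = insert (K + Suc j) {K<..K + j}" by auto
  then show ?case
    by (simp add: fourier_convolution prob_space_conv_from sets_conv_from prob_space_moran_factor
       sets_moran_factor Suc.IH fourier_moran_factor assms mult.commute)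
qed

lemma bessel_levels:
  assumes "finite F"
    and "\<And>x y. x \<in> F \<Longrightarrow> y \<in> F \<Longrightarrow> x \<noteq> y \<Longrightarrow> \<exists>m\<in>{K<..K + j}. level_mask m (x - y) = 0"
  shows "(\<Sum>l\<in>F. (cmod (\<Prod>m\<in>{K<..K + j}. level_mask m (\<xi> + l)))\<^sup>2) \<le> 1"
  using bessel_exponentials[OF prob_space_conv_from[of M digits K j] sets_conv_from assms(1)] assms(2)
  by (simp add: fourier_conv_from prod_zero_iff)

definition annihilated :: "nat \<Rightarrow> real^2 \<Rightarrow> bool" where
  "annihilated K \<xi> \<longleftrightarrow> (\<exists>m>K. level_mask m \<xi> = 0)"

definition pairwise_annihilated :: "nat \<Rightarrow> (real^2) set \<Rightarrow> bool" where
  "pairwise_annihilated K S \<longleftrightarrow> (\<forall>x\<in>S. \<forall>y\<in>S. x \<noteq> y \<longrightarrow> annihilated K (x - y))"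

text \<open>
  The squared modulus of the Fourier transform of the tail beyond level \<open>K\<close>, written as a quotient, which
  spares the construction of the tail as a limit measure.
\<close>
definition tail_weight :: "(real^2 \<Rightarrow> complex) \<Rightarrow> nat \<Rightarrow> real^2 \<Rightarrow> real" where
  "tail_weight \<phi> K \<xi> = (cmod (\<phi> \<xi> / (\<Prod>m\<in>{0<..K}. level_mask m \<xi>)))\<^sup>2"

lemma tail_weight_Suc:
  assumes "level_mask (Suc K) \<xi> \<noteq> 0"
  shows "tail_weight \<phi> K \<xi> = (cmod (level_mask (Suc K) \<xi>))\<^sup>2 * tail_weight \<phi> (Suc K) \<xi>"
proof -
  have "{0<..Suc K} = insert (Suc K) {0<..K}" by auto
  then show ?thesis
    using assms by (simp add: tail_weight_def norm_divide norm_mult power_divide power_mult_distrib)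
qed

text \<open>
  A finite set has finitely many differences, so the levels \<open>K + 1, \<dots>, K + j\<close> already annihilate all of them for
  large \<open>j\<close>. Bessel's inequality for these finite convolutions passes to the limit.
\<close>
lemma tail_bessel:
  assumes lim: "\<And>\<xi>. (\<lambda>n. \<Prod>m\<in>{0<..n}. level_mask m \<xi>) \<longlonglongrightarrow> \<phi> \<xi>"
    and "finite F" "pairwise_annihilated K F"
    and nz: "\<And>l m. l \<in> F \<Longrightarrow> m \<ge> 1 \<Longrightarrow> level_mask m (\<xi> + l) \<noteq> 0"
  shows "(\<Sum>l\<in>F. tail_weight \<phi> K (\<xi> + l)) \<le> 1"
proof -
  have "\<forall>p\<in>F \<times> F. \<exists>m. fst p \<noteq> snd p \<longrightarrow> m > K \<and> level_mask m (fst p - snd p) = 0"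
    using assms(3) by (auto simp: pairwise_annihilated_def annihilated_def)
  \<comment> \<open>For each pair of points, a level that annihilates their difference.\<close>
  from bchoice[OF this] obtain lev where
    lev: "\<forall>p\<in>F \<times> F. fst p \<noteq> snd p \<longrightarrow> lev p > K \<and> level_mask (lev p) (fst p - snd p) = 0" ..
  define N where "N = Max (lev ` (F \<times> F))"
  have N: "lev (x, y) \<le> N" if "x \<in> F" "y \<in> F" for x y
    unfolding N_def using assms(2) that by (intro Max_ge) auto
  have "(\<lambda>j. \<Sum>l\<in>F. (cmod (\<Prod>m\<in>{K<..K + j}. level_mask m (\<xi> + l)))\<^sup>2) \<longlonglongrightarrow> (\<Sum>l\<in>F. tail_weight \<phi> K (\<xi> + l))"
    unfolding tail_weight_def
  proof (intro tendsto_intros)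
    fix l assume "l \<in> F"
    let ?P = "\<lambda>n. \<Prod>m\<in>{0<..n}. level_mask m (\<xi> + l)"
    have "(\<Prod>m\<in>{K<..K + j}. level_mask m (\<xi> + l)) = ?P (j + K) / ?P K" for j
    proof -
      have "{0<..j + K} = {0<..K} \<union> {K<..K + j}" by auto
      then have "?P (j + K) = ?P K * (\<Prod>m\<in>{K<..K + j}. level_mask m (\<xi> + l))"
        by (simp add: prod.union_disjoint)
      moreover have "?P K \<noteq> 0" using nz[OF \<open>l \<in> F\<close>] by simp
      ultimately show ?thesis by simp
    qed
    moreover have "(\<lambda>j. ?P (j + K) / ?P K) \<longlonglongrightarrow> \<phi> (\<xi> + l) / ?P K"
      using nz[OF \<open>l \<in> F\<close>]
      by (intro tendsto_divide[OF LIMSEQ_ignore_initial_segment[OF lim[of "\<xi> + l"], of K] tendsto_const]) simp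
    ultimately show "(\<lambda>j. \<Prod>m\<in>{K<..K + j}. level_mask m (\<xi> + l)) \<longlonglongrightarrow> \<phi> (\<xi> + l) / ?P K"
      by simp
  qed
  moreover have "(\<Sum>l\<in>F. (cmod (\<Prod>m\<in>{K<..K + j}. level_mask m (\<xi> + l)))\<^sup>2) \<le> 1" if "j \<ge> N" for j
  proof (rule bessel_levels[OF assms(2)])
    fix x y assume "x \<in> F" "y \<in> F" "x \<noteq> y"
    with bspec[OF lev, of "(x, y)"] N[of x y] that show "\<exists>m\<in>{K<..K + j}. level_mask m (x - y) = 0"
      by (intro bexI[of _ "lev (x, y)"]) auto
  qed
  ultimately show ?thesis
    by (intro LIMSEQ_le_const2) auto
qed

lemma prod_levels_shift: "(\<Prod>m\<in>{0<..n}. f m) = (\<Prod>i<n. f (Suc i))"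
proof -
  have eq: "{0<..n} = Suc ` {..<n}" unfolding image_Suc_lessThan by auto
  show ?thesis unfolding eq by (subst prod.reindex) (auto simp: o_def)
qed

text \<open>By \<open>y \<le> exp (- (1 - y))\<close>, a positive lower bound for the products bounds the sum of the defects \<open>1 - y\<close>.\<close>
lemma summable_defect_if_limit_nonzero:
  assumes lim: "(\<lambda>n. \<Prod>m\<in>{0<..n}. level_mask m \<xi>) \<longlonglongrightarrow> z" and "z \<noteq> 0"
  shows "summable (\<lambda>i. 1 - (cmod (level_mask (Suc i) \<xi>))\<^sup>2)"
proof -
  define y where "y i = (cmod (level_mask (Suc i) \<xi>))\<^sup>2" for i
  have y: "0 \<le> y i" "y i \<le> 1" for i
    using norm_mask_le_1 by (auto simp: y_def level_mask_def power_le_one)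
  have conv: "(\<lambda>n. \<Prod>i<n. y i) \<longlonglongrightarrow> (cmod z)\<^sup>2"
    using tendsto_power[OF tendsto_norm[OF lim], of 2]
    by (simp add: prod_levels_shift prod_norm[symmetric] prod_power_distrib y_def)
  have "decseq (\<lambda>n. \<Prod>i<n. y i)"
    using y by (intro decseq_SucI) (simp add: mult_left_le prod_nonneg)
  then have ge: "(cmod z)\<^sup>2 \<le> (\<Prod>i<n. y i)" for n
    using conv by (rule decseq_ge)
  have "(\<Sum>i<n. 1 - y i) \<le> - ln ((cmod z)\<^sup>2)" for n
  proof -
    have "(cmod z)\<^sup>2 \<le> (\<Prod>i<n. exp (- (1 - y i)))"
    proof (rule order.trans[OF ge])
      show "(\<Prod>i<n. y i) \<le> (\<Prod>i<n. exp (- (1 - y i)))"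
        using exp_ge_add_one_self[of "y _ - 1"] y by (intro prod_mono) (auto simp: algebra_simps)
    qed
    also have "\<dots> = exp (- (\<Sum>i<n. 1 - y i))"
      by (simp add: exp_sum flip: sum_negf)
    finally have "ln ((cmod z)\<^sup>2) \<le> - (\<Sum>i<n. 1 - y i)"
      using \<open>z \<noteq> 0\<close> by (subst ln_exp[symmetric], subst ln_le_cancel_iff) auto
    then show ?thesis by simp
  qed
  then have "summable (\<lambda>i. 1 - y i)"
    using y by (intro summableI_nonneg_bounded) auto
  then show ?thesis by (simp add: y_def)
qed

lemma limit_nonzero_if_summable_defect:
  assumes lim: "(\<lambda>n. \<Prod>m\<in>{0<..n}. level_mask m \<xi>) \<longlonglongrightarrow> z"
    and summ: "summable (\<lambda>i. 1 - (cmod (level_mask (Suc i) \<xi>))\<^sup>2)"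
    and nz: "\<And>m. m \<ge> 1 \<Longrightarrow> level_mask m \<xi> \<noteq> 0"
  shows "z \<noteq> 0"
proof
  assume "z = 0"
  define y where "y i = (cmod (level_mask (Suc i) \<xi>))\<^sup>2" for i
  have y: "y i \<noteq> 0" "y i \<le> 1" for i
    using norm_mask_le_1 nz[of "Suc i"] by (auto simp: y_def level_mask_def power_le_one)
  have "summable (\<lambda>i. norm (y i - 1))"
  proof -
    have "norm (y i - 1) = 1 - y i" for i using y(2)[of i] by simp
    then show ?thesis using summ by (simp only: y_def)
  qed
  then have "convergent_prod y"
    by (intro abs_convergent_prod_imp_convergent_prod) (simp add: abs_convergent_prod_conv_summable)
  then obtain L where L: "(\<lambda>n. \<Prod>i\<le>n. y i) \<longlonglongrightarrow> L" "L \<noteq> 0"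
    using convergent_prod_iff_nz_lim[of y] y(1) by auto
  have "(\<lambda>n. \<Prod>i<n. y i) \<longlonglongrightarrow> 0"
    using tendsto_power[OF tendsto_norm[OF lim], of 2] \<open>z = 0\<close>
    by (simp add: prod_levels_shift prod_norm[symmetric] prod_power_distrib y_def)
  then have "(\<lambda>n. \<Prod>i<Suc n. y i) \<longlonglongrightarrow> 0" by (rule LIMSEQ_Suc)
  with L show False using LIMSEQ_unique by (auto simp: lessThan_Suc_atMost)
qed

text \<open>
  The limit is near \<open>1\<close> at the point \<open>\<xi> / 2\<^sup>r\<close> for large \<open>r\<close>, so the defects \<open>1 - |m\<^sub>n|\<^sup>2\<close> are summable there.
  Doubling the frequency multiplies each defect by at most \<open>4\<close>, which carries summability back to \<open>\<xi>\<close>.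
  A product with summable defects and no zero factor does not tend to zero.
\<close>
lemma infinite_product_nonzero:
  assumes lim: "\<And>\<xi>. (\<lambda>n. \<Prod>m\<in>{0<..n}. level_mask m \<xi>) \<longlonglongrightarrow> \<phi> \<xi>"
    and "isCont \<phi> 0" "\<phi> 0 = 1"
    and nz: "\<And>m. m \<ge> 1 \<Longrightarrow> level_mask m \<xi> \<noteq> 0"
  shows "\<phi> \<xi> \<noteq> 0"
proof -
  let ?defect = "\<lambda>\<xi> i. 1 - (cmod (level_mask (Suc i) \<xi>))\<^sup>2"
  have double: "summable (?defect (2 *\<^sub>R \<eta>))" if "summable (?defect \<eta>)" for \<eta>
  proof (rule summable_comparison_test'[where g = "\<lambda>i. 4 * ?defect \<eta> i"])
    show "summable (\<lambda>i. 4 * ?defect \<eta> i)" using that by (rule summable_mult)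
    show "norm (?defect (2 *\<^sub>R \<eta>) i) \<le> 4 * ?defect \<eta> i" for i
      using one_minus_norm_mask_square_double norm_mask_le_1
      by (simp add: level_mask_def phase_scale power_le_one)
  qed
  have scale: "summable (?defect (2 ^ r *\<^sub>R \<eta>))" if "summable (?defect \<eta>)" for \<eta> r
  proof (induction r)
    case (Suc r)
    show ?case using double[OF Suc.IH] by simp
  qed (use that in simp)
  have "((\<lambda>r. (1 / 2 ^ r) *\<^sub>R \<xi>) \<longlongrightarrow> 0 *\<^sub>R \<xi>) sequentially"
    using LIMSEQ_divide_realpow_zero[of 2 1] by (intro tendsto_intros) simp
  then have "(\<lambda>r. \<phi> ((1 / 2 ^ r) *\<^sub>R \<xi>)) \<longlonglongrightarrow> \<phi> 0"
    using isCont_tendsto_compose[OF assms(2)] by simp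
  then have "\<forall>\<^sub>F r in sequentially. \<phi> ((1 / 2 ^ r) *\<^sub>R \<xi>) \<noteq> 0"
    using assms(3) by (intro tendsto_imp_eventually_ne) auto
  then obtain r where "\<phi> ((1 / 2 ^ r) *\<^sub>R \<xi>) \<noteq> 0"
    by (auto simp: eventually_sequentially)
  then have "summable (?defect ((1 / 2 ^ r) *\<^sub>R \<xi>))"
    by (rule summable_defect_if_limit_nonzero[OF lim])
  from scale[OF this, of r] have "summable (?defect \<xi>)" by simp
  then show ?thesis using limit_nonzero_if_summable_defect[OF lim] nz by blast
qed

end

section \<open>Descending a spectrum through the levels\<close>

locale generic_point = digit_system +
  fixes \<phi> :: "real^2 \<Rightarrow> complex" and \<xi> :: "real^2" and \<Lambda> :: "(real^2) set"
  assumes product_limit: "\<And>\<eta>. (\<lambda>n. \<Prod>m\<in>{0<..n}. level_mask m \<eta>) \<longlonglongrightarrow> \<phi> \<eta>"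
    and continuous_at_0: "isCont \<phi> 0" and at_0: "\<phi> 0 = 1"
    and generic: "\<And>l n. l \<in> \<Lambda> \<Longrightarrow> n \<ge> 1 \<Longrightarrow> \<not> in_half_lattice n (\<xi> + l)"
begin

text \<open>
  A tight set behaves like a spectrum of the tail beyond level \<open>K\<close>, except that Parseval's identity is
  required only for the exponential with frequency \<open>- \<xi>\<close>.
\<close>
definition tight :: "nat \<Rightarrow> (real^2) set \<Rightarrow> bool" where
  "tight K S \<longleftrightarrow> S \<subseteq> \<Lambda> \<and> pairwise_annihilated K S \<and> ((\<lambda>l. tail_weight \<phi> K (\<xi> + l)) has_sum 1) S"

lemma level_mask_nonzero: "l \<in> \<Lambda> \<Longrightarrow> n \<ge> 1 \<Longrightarrow> level_mask n (\<xi> + l) \<noteq> 0"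
  using generic by (simp add: level_mask_eq_0_iff)

lemma tail_weight_pos: "l \<in> \<Lambda> \<Longrightarrow> 0 < tail_weight \<phi> K (\<xi> + l)"
  using infinite_product_nonzero[OF product_limit continuous_at_0 at_0, of "\<xi> + l"] level_mask_nonzero
  by (simp add: tail_weight_def)

lemma tail_weight_nonneg: "0 \<le> tail_weight \<phi> K x"
  by (simp add: tail_weight_def)

context
  fixes K :: nat and S :: "(real^2) set"
  assumes tight: "tight K S"
begin

definition block :: "real^2 \<Rightarrow> (real^2) set" where
  "block l = {x\<in>S. in_half_lattice (Suc K) (x - l)}"

definition rep :: "(real^2) set \<Rightarrow> real^2" where
  "rep b = (SOME x. x \<in> b)"

text \<open>
  The coset of the lattice of level \<open>K + 1\<close> inside a block. It has no canonical name, so it is described by the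
  offset from a representative of the block, whose phases are half integers.
\<close>
definition kind :: "real^2 \<Rightarrow> bool \<times> bool" where
  "kind l = (phase1 (Suc K) (l - rep (block l)) \<in> \<int>, phase2 (Suc K) (l - rep (block l)) \<in> \<int>)"

lemma S_subset: "S \<subseteq> \<Lambda>"
  using tight by (simp add: tight_def)

lemma S_annihilated: "x \<in> S \<Longrightarrow> y \<in> S \<Longrightarrow> x \<noteq> y \<Longrightarrow> annihilated K (x - y)"
  using tight by (simp add: tight_def pairwise_annihilated_def)

lemma rep_block:
  assumes "l \<in> S"
  shows "rep (block l) \<in> S" "in_half_lattice (Suc K) (l - rep (block l))"
proof -
  have "l \<in> block l" using assms by (simp add: block_def in_half_lattice_zero)
  then have "rep (block l) \<in> block l" unfolding rep_def by (rule someI)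
  then show "rep (block l) \<in> S" "in_half_lattice (Suc K) (l - rep (block l))"
    by (auto simp: block_def intro: in_half_lattice_commute)
qed

lemma block_eq_iff:
  assumes "x \<in> S" "y \<in> S"
  shows "block x = block y \<longleftrightarrow> in_half_lattice (Suc K) (x - y)"
proof
  assume eq: "block x = block y"
  have "x \<in> block x" using assms(1) by (simp add: block_def in_half_lattice_zero)
  then have "x \<in> block y" unfolding eq .
  then show "in_half_lattice (Suc K) (x - y)" by (simp add: block_def)
next
  assume "in_half_lattice (Suc K) (x - y)"
  then have "in_half_lattice (Suc K) (z - x) \<longleftrightarrow> in_half_lattice (Suc K) (z - y)" for z
    using in_half_lattice_trans[of "Suc K" z x y] in_half_lattice_trans[of "Suc K" z y x]
      in_half_lattice_commute[of "Suc K" x y] by blast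
  then show "block x = block y" by (simp add: block_def)
qed

lemma kind_eq_iff:
  assumes "x \<in> S" "y \<in> S" "block x = block y"
  shows "kind x = kind y \<longleftrightarrow> phase1 (Suc K) (x - y) \<in> \<int> \<and> phase2 (Suc K) (x - y) \<in> \<int>"
proof -
  let ?r = "rep (block y)"
  have hx: "in_half_lattice (Suc K) (x - ?r)" using rep_block(2)[OF assms(1)] unfolding assms(3) .
  have hy: "in_half_lattice (Suc K) (y - ?r)" using rep_block(2)[OF assms(2)] .
  have "kind x = kind y \<longleftrightarrow>
    phase1 (Suc K) (x - ?r) - phase1 (Suc K) (y - ?r) \<in> \<int> \<and> phase2 (Suc K) (x - ?r) - phase2 (Suc K) (y - ?r) \<in> \<int>"
    unfolding kind_def assms(3) prod.inject
    using half_integer_parity_eq_iff[of "phase1 (Suc K) (x - ?r)" "phase1 (Suc K) (y - ?r)"]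
      half_integer_parity_eq_iff[of "phase2 (Suc K) (x - ?r)" "phase2 (Suc K) (y - ?r)"] hx hy
    unfolding in_half_lattice_def by blast
  then show ?thesis by (simp add: phase_diff)
qed

text \<open>
  The selection principle applies because a difference that stays within one kind, or that leaves the block, is
  not a zero of the mask of level \<open>K + 1\<close>, hence is annihilated beyond that level.
\<close>
lemma selection:
  "\<And>b c d. b \<in> block ` S \<Longrightarrow>
     infsum (\<lambda>l. tail_weight \<phi> (Suc K) (\<xi> + l)) {x\<in>S. block x = b \<and> kind x = c} =
     infsum (\<lambda>l. tail_weight \<phi> (Suc K) (\<xi> + l)) {x\<in>S. block x = b \<and> kind x = d}"
  "\<And>\<sigma>. tight (Suc K) {x\<in>S. kind x = \<sigma> (block x)}"
proof -
  \<comment> \<open>The squared mask at \<open>\<xi> + l\<close> for \<open>l\<close> of kind \<open>c\<close> in \<open>b\<close>, defined whether or not the kind occurs.\<close>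
  define u where "u b c = (cmod (mask (phase1 (Suc K) (\<xi> + rep b) + half_shift (fst c))
     (phase2 (Suc K) (\<xi> + rep b) + half_shift (snd c))))\<^sup>2" for b and c :: "bool \<times> bool"
  have annih: "pairwise_annihilated (Suc K) {x\<in>S. kind x = \<sigma> (block x)}" for \<sigma>
    unfolding pairwise_annihilated_def
  proof (intro ballI impI)
    fix x y assume x: "x \<in> {x\<in>S. kind x = \<sigma> (block x)}" and y: "y \<in> {x\<in>S. kind x = \<sigma> (block x)}" and "x \<noteq> y"
    then have "annihilated K (x - y)" by (intro S_annihilated) auto
    then obtain m where m: "m > K" "level_mask m (x - y) = 0" unfolding annihilated_def by blast
    have "m \<noteq> Suc K"
    proof
      assume "m = Suc K"
      with m(2) have h: "in_half_lattice (Suc K) (x - y)"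
        and n: "\<not> (phase1 (Suc K) (x - y) \<in> \<int> \<and> phase2 (Suc K) (x - y) \<in> \<int>)"
        by (simp_all add: level_mask_eq_0_iff)
      have S: "x \<in> S" "y \<in> S" using x y by simp_all
      from h have blk: "block x = block y" using block_eq_iff[OF S] by simp
      then have "kind x = kind y" using x y by simp
      with n kind_eq_iff[OF S blk] show False by blast
    qed
    with m show "annihilated (Suc K) (x - y)" unfolding annihilated_def by (intro exI[of _ m]) simp
  qed
  have bessel: "sum (\<lambda>l. tail_weight \<phi> (Suc K) (\<xi> + l)) F \<le> 1"
    if "finite F" "F \<subseteq> {x\<in>S. kind x = \<sigma> (block x)}" for \<sigma> F
  proof (rule tail_bessel[OF product_limit that(1)])
    show "pairwise_annihilated (Suc K) F"
      using annih[of \<sigma>] that(2) by (auto simp: pairwise_annihilated_def)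
    show "level_mask m (\<xi> + l) \<noteq> 0" if "l \<in> F" "m \<ge> 1" for l m
      using that \<open>F \<subseteq> _\<close> S_subset by (intro level_mask_nonzero) auto
  qed
  have weight: "tail_weight \<phi> K (\<xi> + l) = u (block l) (kind l) * tail_weight \<phi> (Suc K) (\<xi> + l)" if "l \<in> S" for l
  proof -
    let ?r = "rep (block l)"
    let ?a = "phase1 (Suc K) (l - ?r)" and ?b = "phase2 (Suc K) (l - ?r)"
    have h: "2 * ?a \<in> \<int>" "2 * ?b \<in> \<int>"
      using rep_block(2)[OF that] by (auto simp: in_half_lattice_def)
    have "level_mask (Suc K) (\<xi> + l) =
       mask ((phase1 (Suc K) (\<xi> + ?r) + half_shift (?a \<in> \<int>)) + (?a - half_shift (?a \<in> \<int>)))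
            ((phase2 (Suc K) (\<xi> + ?r) + half_shift (?b \<in> \<int>)) + (?b - half_shift (?b \<in> \<int>)))"
      by (simp add: level_mask_def phase_add phase_diff)
    also have "\<dots> = mask (phase1 (Suc K) (\<xi> + ?r) + half_shift (?a \<in> \<int>)) (phase2 (Suc K) (\<xi> + ?r) + half_shift (?b \<in> \<int>))"
      by (intro mask_shift_Ints half_integer_cases h)
    finally have "u (block l) (kind l) = (cmod (level_mask (Suc K) (\<xi> + l)))\<^sup>2"
      by (simp add: u_def kind_def)
    then show ?thesis
      using tail_weight_Suc level_mask_nonzero[of l "Suc K"] that S_subset by auto
  qed
  have u_pos: "0 < u b c" if b: "b \<in> block ` S" for b c
  proof -
    have "\<not> in_half_lattice (Suc K) (\<xi> + rep b)"
      using b rep_block(1) S_subset by (intro generic) auto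
    moreover have "2 * (x + half_shift d) \<in> \<int> \<longleftrightarrow> 2 * x \<in> \<int>" for x d
    proof (cases d)
      case False
      have "2 * (x + half_shift d) = 2 * x + 1" using False by (simp add: half_shift_def)
      then show ?thesis using Ints_add[of "2 * x" 1] Ints_diff[of "2 * x + 1" 1] by auto
    qed (simp add: half_shift_def)
    ultimately show ?thesis
      unfolding u_def in_half_lattice_def by (auto simp: mask_eq_0_iff)
  qed
  have total: "((\<lambda>l. tail_weight \<phi> K (\<xi> + l)) has_sum 1) S"
    using tight by (simp add: tight_def)
  note principle = selection_principle[where w = "\<lambda>l. tail_weight \<phi> K (\<xi> + l)" and u = u and blk = block
      and kind = kind and v = "\<lambda>l. tail_weight \<phi> (Suc K) (\<xi> + l)" and X = S,
      OF weight tail_weight_nonneg u_pos _ total bessel]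
  have usum: "(\<Sum>c\<in>UNIV. u b c) = 1" for b
    unfolding u_def by (rule sum_norm_mask_half_shifts)
  show "infsum (\<lambda>l. tail_weight \<phi> (Suc K) (\<xi> + l)) {x\<in>S. block x = b \<and> kind x = c} =
     infsum (\<lambda>l. tail_weight \<phi> (Suc K) (\<xi> + l)) {x\<in>S. block x = b \<and> kind x = d}"
    if "b \<in> block ` S" for b c d
    by (rule principle(1)) (use that usum in auto)
  show "tight (Suc K) {x\<in>S. kind x = \<sigma> (block x)}" for \<sigma>
    unfolding tight_def
  proof (intro conjI annih)
    show "{x\<in>S. kind x = \<sigma> (block x)} \<subseteq> \<Lambda>" using S_subset by auto
    show "((\<lambda>l. tail_weight \<phi> (Suc K) (\<xi> + l)) has_sum 1) {x\<in>S. kind x = \<sigma> (block x)}"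
      by (rule principle(2)) (use usum in auto)
  qed
qed

text \<open>
  The kind of \<open>l\<close> has a positive tail sum, because the infinite product has no zero at \<open>\<xi> + l\<close>. The other
  kinds of the block have the same tail sum, so they are not empty.
\<close>
lemma all_kinds_occur:
  assumes "l \<in> S"
  shows "\<exists>x\<in>S. phase1 (Suc K) (x - l) - half_shift c1 \<in> \<int> \<and> phase2 (Suc K) (x - l) - half_shift c2 \<in> \<int>"
proof -
  let ?v = "\<lambda>l. tail_weight \<phi> (Suc K) (\<xi> + l)"
  let ?r = "rep (block l)"
  let ?T = "\<lambda>c. {x\<in>S. block x = block l \<and> kind x = c}"
  define c where "c = (phase1 (Suc K) (l - ?r) + half_shift c1 \<in> \<int>, phase2 (Suc K) (l - ?r) + half_shift c2 \<in> \<int>)"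
  have "?v summable_on {x\<in>S. kind x = kind l}"
    using selection(2)[of "\<lambda>_. kind l"] by (auto simp: tight_def has_sum_iff)
  then have "?v summable_on ?T (kind l)"
    by (rule summable_on_subset_banach) auto
  then have "?v l \<le> infsum ?v (?T (kind l))"
    using finite_sum_le_infsum[of ?v "?T (kind l)" "{l}"] assms tail_weight_nonneg by auto
  also have "\<dots> = infsum ?v (?T c)" using assms by (intro selection(1)) auto
  finally have "infsum ?v (?T c) > 0"
    using tail_weight_pos[of l "Suc K"] assms S_subset by (meson less_le_trans subsetD)
  then have "?T c \<noteq> {}" by (metis infsum_empty less_irrefl)
  then obtain x where x: "x \<in> S" "block x = block l" "kind x = c" by auto
  have *: "a - d - half_shift e \<in> \<int>"
    if "2 * a \<in> \<int>" "2 * d \<in> \<int>" "a \<in> \<int> \<longleftrightarrow> d + half_shift e \<in> \<int>" for a d :: real and e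
  proof -
    have "2 * (d + half_shift e) \<in> \<int>" using that(2) by (auto simp: half_shift_def distrib_left)
    then show ?thesis using half_integer_parity_eq_iff[OF that(1), of "d + half_shift e"] that(3)
      by (simp add: algebra_simps)
  qed
  have "in_half_lattice (Suc K) (x - ?r)" using rep_block(2)[OF x(1)] x(2) by simp
  with rep_block(2)[OF assms] x(2,3)
  have "phase1 (Suc K) (x - ?r) - phase1 (Suc K) (l - ?r) - half_shift c1 \<in> \<int>"
       "phase2 (Suc K) (x - ?r) - phase2 (Suc K) (l - ?r) - half_shift c2 \<in> \<int>"
    by (auto simp: in_half_lattice_def c_def kind_def intro!: *)
  with x(1) show ?thesis by (auto simp: phase_diff intro!: bexI[of _ x])
qed

text \<open>
  Within a block, phases of differences are half integers, and a half integer has odd denominator only if it is an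
  integer; so the class of \<open>l0\<close> contains at most one kind of each block. It contains one because the
  phases of \<open>x - l0\<close> lie in half of the ring \<open>odd_frac\<close>, can be corrected by half shifts, and all kinds occur.
\<close>
lemma tight_odd_class:
  assumes l0: "l0 \<in> S"
  shows "tight (Suc K) {x\<in>S. odd_dual (Suc K) (x - l0)}"
proof -
  \<comment> \<open>The kind of the elements of the block that are equivalent to \<open>l0\<close>.\<close>
  define \<sigma> where "\<sigma> b = (SOME c. \<exists>x\<in>b. kind x = c \<and> odd_dual (Suc K) (x - l0))" for b
  have \<sigma>: "\<exists>y\<in>S. block y = block x \<and> kind y = \<sigma> (block x) \<and> odd_dual (Suc K) (y - l0)"
    if "x \<in> S" "y \<in> S" "block y = block x" "odd_dual (Suc K) (y - l0)" for x y
  proof -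
    have "y \<in> block x" using block_eq_iff[OF that(2,1)] that(2,3) by (simp add: block_def)
    with that(4) have "\<exists>c. \<exists>y\<in>block x. kind y = c \<and> odd_dual (Suc K) (y - l0)" by blast
    from someI_ex[OF this] obtain y where "y \<in> block x" "kind y = \<sigma> (block x)" "odd_dual (Suc K) (y - l0)"
      unfolding \<sigma>_def by blast
    moreover from \<open>y \<in> block x\<close> have "y \<in> S" "in_half_lattice (Suc K) (y - x)" by (simp_all add: block_def)
    moreover from this have "block y = block x" using block_eq_iff that(1) by simp
    ultimately show ?thesis by blast
  qed
  have same: "odd_dual (Suc K) (x - l0) \<longleftrightarrow> kind x = \<sigma> (block x)" if xS: "x \<in> S" for x
  proof
    assume "odd_dual (Suc K) (x - l0)"
    then obtain y where y: "y \<in> S" "block y = block x" "kind y = \<sigma> (block x)" "odd_dual (Suc K) (y - l0)"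
      using \<sigma>[OF xS xS] by blast
    have "odd_dual (Suc K) (x - y)"
      using odd_dual_diff[OF \<open>odd_dual (Suc K) (x - l0)\<close> y(4)] by simp
    moreover have "in_half_lattice (Suc K) (x - y)" using block_eq_iff[OF xS y(1)] y(2) by simp
    ultimately have "phase1 (Suc K) (x - y) \<in> \<int> \<and> phase2 (Suc K) (x - y) \<in> \<int>"
      by (auto simp: odd_dual_iff_phase in_half_lattice_def intro: Ints_if_odd_frac)
    then show "kind x = \<sigma> (block x)" using kind_eq_iff[OF xS y(1)] y by simp
  next
    assume k: "kind x = \<sigma> (block x)"
    have "odd_dual (Suc K) (2 *\<^sub>R (x - l0))"
    proof (cases "x = l0")
      case True
      then show ?thesis using dual_diff[of "Suc K" 0 0] by (simp add: odd_dual_def Ints_odd_frac)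
    next
      case False
      then have "annihilated K (x - l0)" using xS l0 by (intro S_annihilated)
      then obtain m where "m > K" "level_mask m (x - l0) = 0" unfolding annihilated_def by blast
      then show ?thesis by (intro level_mask_zero_imp_odd_dual[of m]) auto
    qed
    then obtain c1 c2 where c: "phase1 (Suc K) (x - l0) - half_shift c1 \<in> odd_frac"
        "phase2 (Suc K) (x - l0) - half_shift c2 \<in> odd_frac"
      using ex_half_shift_odd_frac[of "phase1 (Suc K) (x - l0)"] ex_half_shift_odd_frac[of "phase2 (Suc K) (x - l0)"]
      by (auto simp: odd_dual_iff_phase phase_scale)
    obtain y where y: "y \<in> S" "phase1 (Suc K) (y - x) - half_shift c1 \<in> \<int>" "phase2 (Suc K) (y - x) - half_shift c2 \<in> \<int>"
      using all_kinds_occur[OF xS] by blast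
    have twice: "2 * half_shift d \<in> \<int>" for d by (simp add: half_shift_def)
    have "2 * e \<in> \<int>" if "e - half_shift d \<in> \<int>" for e d
    proof -
      have "2 * e = 2 * (e - half_shift d) + 2 * half_shift d" by simp
      also have "\<dots> \<in> \<int>" by (intro Ints_add Ints_mult that twice) simp
      finally show ?thesis .
    qed
    with y(2,3) have "2 * phase1 (Suc K) (y - x) \<in> \<int>" "2 * phase2 (Suc K) (y - x) \<in> \<int>" by blast+
    then have "in_half_lattice (Suc K) (y - x)" by (simp add: in_half_lattice_def)
    then have "block y = block x" using block_eq_iff y(1) xS by simp
    moreover have "odd_dual (Suc K) (y - l0)"
    proof -
      have "a + b \<in> odd_frac" if "a - half_shift d \<in> odd_frac" "b - half_shift d \<in> \<int>" for a b d
      proof -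
        have "a + b = (a - half_shift d) + ((b - half_shift d) + 2 * half_shift d)" by simp
        also have "\<dots> \<in> odd_frac" by (intro odd_frac_add Ints_odd_frac[OF that(2)] Ints_odd_frac[OF twice] that(1))
        finally show ?thesis .
      qed
      moreover have "phase1 (Suc K) (y - l0) = phase1 (Suc K) (x - l0) + phase1 (Suc K) (y - x)"
           "phase2 (Suc K) (y - l0) = phase2 (Suc K) (x - l0) + phase2 (Suc K) (y - x)"
        by (simp_all add: phase_diff)
      ultimately show ?thesis
        using c y(2,3) odd_dual_iff_phase[of "Suc K" "y - l0"] by simp
    qed
    ultimately obtain z where z: "z \<in> S" "block z = block x" "kind z = \<sigma> (block x)" "odd_dual (Suc K) (z - l0)"
      using \<sigma>[OF xS y(1)] by blast
    have "phase1 (Suc K) (x - z) \<in> \<int> \<and> phase2 (Suc K) (x - z) \<in> \<int>"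
      using kind_eq_iff[OF xS z(1)] z k by simp
    then have "odd_dual (Suc K) (x - z)" by (auto simp: odd_dual_iff_phase Ints_odd_frac)
    from odd_dual_add[OF this z(4)] show "odd_dual (Suc K) (x - l0)" by simp
  qed
  have "{x\<in>S. odd_dual (Suc K) (x - l0)} = {x\<in>S. kind x = \<sigma> (block x)}" using same by blast
  then show ?thesis using selection(2) by simp
qed

end

lemma tight_nonempty: "tight K S \<Longrightarrow> S \<noteq> {}"
  by (auto simp: tight_def has_sum_iff)

lemma ex_tight_odd_class:
  assumes "tight 0 \<Lambda>"
  shows "\<exists>S. tight K S \<and> (K \<ge> 1 \<longrightarrow> (\<forall>x\<in>S. \<forall>y\<in>S. odd_dual K (x - y)))"
proof (induction K)
  case (Suc K)
  then obtain S where S: "tight K S" by blast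
  then obtain l0 where "l0 \<in> S" using tight_nonempty by blast
  from tight_odd_class[OF S this] have "tight (Suc K) {x\<in>S. odd_dual (Suc K) (x - l0)}" .
  moreover have "odd_dual (Suc K) (x - y)" if "odd_dual (Suc K) (x - l0)" "odd_dual (Suc K) (y - l0)" for x y
    using odd_dual_diff[OF that] by simp
  ultimately show ?case by blast
qed (use assms in auto)

text \<open>
  Two points \<open>x\<close> of a tight class of level \<open>K = n - 1\<close> suffice, whose offsets from a point \<open>l\<close> of the class have
  phases in \<open>(1/2, 0)\<close> and \<open>(0, 1/2)\<close> modulo \<open>1\<close> at level \<open>n\<close>. Being in the class makes the coordinates of
  \<open>x - l\<close> at level \<open>K\<close> fractions with odd denominator. By Cramer's rule, \<open>p\<^sub>n\<close> times the \<open>j\<close>-th of these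
  coordinates is an integer combination of the phases, whose coefficients \<open>U\<close> and \<open>V\<close>, when halved, must have odd
  denominators; so they are even. They are the entries of column \<open>j\<close> of \<open>M\<^sub>n\<close> multiplied by a matrix of determinant \<open>p\<^sub>n\<close>, which is odd.
\<close>
lemma matrix_entries_even:
  assumes "tight 0 \<Lambda>" "n \<ge> 2"
  shows "even (M n $ i $ j)"
proof -
  obtain K where n: "n = Suc K" "K \<ge> 1" using assms(2) by (cases n) auto
  obtain S where S: "tight K S" "\<And>x y. x \<in> S \<Longrightarrow> y \<in> S \<Longrightarrow> odd_dual K (x - y)"
    using ex_tight_odd_class[OF assms(1), of K] n(2) by blast
  then obtain l where l: "l \<in> S" using tight_nonempty by blast
  let ?a1 = "\<alpha> n $ 1" and ?a2 = "\<alpha> n $ 2" and ?b1 = "\<beta> n $ 1" and ?b2 = "\<beta> n $ 2"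
  let ?p = "?a1 * ?b2 - ?a2 * ?b1"
  define U where "U = M n $ 1 $ j * ?b2 - M n $ 2 $ j * ?b1"
  define V where "V = M n $ 2 $ j * ?a1 - M n $ 1 $ j * ?a2"
  have combination: "of_int U * phase1 n x + of_int V * phase2 n x = of_int ?p * dual K x $ j" for x
    unfolding dual_Suc_coord[of K] phase_coords n(1)[symmetric] U_def V_def by (simp add: algebra_simps)
  have uv: "of_int U * half_shift c1 + of_int V * half_shift c2 \<in> odd_frac" for c1 c2
  proof -
    obtain x where x: "x \<in> S" "phase1 n (x - l) - half_shift c1 \<in> \<int>" "phase2 n (x - l) - half_shift c2 \<in> \<int>"
      using all_kinds_occur[OF S(1) l] n(1) by blast
    have "of_int ?p * dual K (x - l) $ j \<in> odd_frac"
      using S(2)[OF x(1) l] unfolding odd_dual_def by (intro odd_frac_mult[OF Ints_odd_frac]) auto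
    moreover have "of_int U * (phase1 n (x - l) - half_shift c1) + of_int V * (phase2 n (x - l) - half_shift c2) \<in> odd_frac"
      using x by (intro Ints_odd_frac Ints_add Ints_mult) auto
    ultimately have "of_int ?p * dual K (x - l) $ j -
       (of_int U * (phase1 n (x - l) - half_shift c1) + of_int V * (phase2 n (x - l) - half_shift c2)) \<in> odd_frac"
      by (rule odd_frac_diff)
    then show ?thesis unfolding combination[symmetric] by (simp add: algebra_simps)
  qed
  have "even U" using uv[of False True] half_odd_frac_of_int[of U] by (simp add: half_shift_def)
  moreover have "even V" using uv[of True False] half_odd_frac_of_int[of V] by (simp add: half_shift_def)
  ultimately have "even (?a1 * U + ?b1 * V)" "even (?a2 * U + ?b2 * V)" by simp_all
  moreover have "?a1 * U + ?b1 * V = ?p * M n $ 1 $ j" "?a2 * U + ?b2 * V = ?p * M n $ 2 $ j"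
    unfolding U_def V_def by (simp_all add: algebra_simps)
  moreover have "odd ?p" using odd_det assms(2) by simp
  ultimately have "even (M n $ 1 $ j)" "even (M n $ 2 $ j)" by (metis even_mult_iff)+
  then show ?thesis using exhaust_2[of i] by auto
qed

end

section \<open>Evenness of the matrices\<close>

theorem theorem1p4:
  fixes M :: "nat \<Rightarrow> int^2^2"
    and D :: "nat \<Rightarrow> (int^2) set"
    and \<alpha> \<beta> :: "nat \<Rightarrow> int^2"
    and p :: "nat \<Rightarrow> int"
    and \<mu> :: "(real^2) measure"
  assumes "\<And>n. n \<ge> 1 \<Longrightarrow> M n \<in> GL2_Z"
    and "\<And>n. n \<ge> 1 \<Longrightarrow> expanding (real_mat (M n))"
    and "\<And>n. n \<ge> 1 \<Longrightarrow> D n = {0, \<alpha> n, \<beta> n, - \<alpha> n - \<beta> n}"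
    and "\<And>n. n \<ge> 1 \<Longrightarrow> p n = \<alpha> n $ 1 * \<beta> n $ 2 - \<alpha> n $ 2 * \<beta> n $ 1"
    and "\<And>n. n \<ge> 1 \<Longrightarrow> p n mod 2 \<noteq> 0"
    and "\<And>n. n \<ge> 1 \<Longrightarrow> \<bar>det (M n)\<bar> \<ge> 4"
    and "\<exists>B. \<forall>n\<ge>1. \<bar>p n\<bar> \<le> B"
    and "is_moran_measure M D \<mu>"
    and "spectral_measure \<mu>"
  shows "\<forall>n\<ge>2. M n \<in> GL2_2Z"
proof -
  interpret digit_system M \<alpha> \<beta>
  proof
    fix n :: nat assume "n \<ge> 1"
    then show "det (M n) \<noteq> 0" using assms(1) by (simp add: GL2_Z_def)
    show "odd (\<alpha> n $ 1 * \<beta> n $ 2 - \<alpha> n $ 2 * \<beta> n $ 1)"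
      using assms(4,5)[OF \<open>n \<ge> 1\<close>] by presburger
  qed
  have D: "D n = digits n" if "n \<ge> 1" for n using assms(3)[OF that] by (simp add: digits_def)
  have weak: "weak_limit (moran_conv M D) \<mu>" using assms(8) by (simp add: is_moran_measure_def)
  then have \<mu>: "prob_space \<mu>" "sets \<mu> = sets borel" by (auto simp: weak_limit_def)
  obtain \<Lambda> where \<Lambda>: "is_spectrum \<mu> \<Lambda>" using assms(9) by (auto simp: spectral_measure_def)
  then have "countable \<Lambda>" by (simp add: is_spectrum_def)
  from ex_generic_shift[OF this] obtain \<xi> where
    "\<forall>l\<in>\<Lambda>. \<forall>n\<ge>1. \<not> in_half_lattice n (\<xi> + l)" ..
  then have \<xi>: "\<And>l n. l \<in> \<Lambda> \<Longrightarrow> n \<ge> 1 \<Longrightarrow> \<not> in_half_lattice n (\<xi> + l)"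
    by simp
  have lim: "(\<lambda>n. \<Prod>m\<in>{0<..n}. level_mask m \<eta>) \<longlonglongrightarrow> fourier \<mu> \<eta>" for \<eta>
  proof -
    have "(\<lambda>n. fourier (moran_conv M D n) \<eta>) \<longlonglongrightarrow> fourier \<mu> \<eta>"
      by (rule tendsto_fourier_weak_limit[OF weak])
         (simp_all only: moran_conv_eq_conv_from prob_space_conv_from sets_conv_from)
    then show ?thesis
      by (simp only: moran_conv_eq_conv_from fourier_conv_from[OF D] add_0)
  qed
  interpret generic_point M \<alpha> \<beta> "fourier \<mu>" \<xi> \<Lambda>
    by unfold_locales (fact lim isCont_fourier[OF \<mu>] fourier_zero[OF \<mu>(1)] \<xi>)+
  have "tight 0 \<Lambda>"
    unfolding tight_def
  proof (intro conjI)
    show "pairwise_annihilated 0 \<Lambda>"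
      unfolding pairwise_annihilated_def annihilated_def
    proof (intro ballI impI)
      fix x y assume "x \<in> \<Lambda>" "y \<in> \<Lambda>" "x \<noteq> y"
      then have "fourier \<mu> (x - y) = 0" by (rule spectrum_imp_orthogonal[OF \<Lambda>])
      then have "\<exists>m\<ge>1. level_mask m (x - y) = 0"
        using infinite_product_nonzero[OF lim isCont_fourier[OF \<mu>] fourier_zero[OF \<mu>(1)], of "x - y"] by blast
      then show "\<exists>m>0. level_mask m (x - y) = 0" by (simp add: Suc_le_eq)
    qed
    show "((\<lambda>l. tail_weight (fourier \<mu>) 0 (\<xi> + l)) has_sum 1) \<Lambda>"
      using spectrum_imp_parseval[OF \<Lambda> \<mu>, of \<xi>] by (simp add: tail_weight_def)
  qed simp
  show ?thesis
  proof (intro allI impI)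
    fix n :: nat assume "n \<ge> 2"
    then have "M n $ i $ j \<in> range (\<lambda>k. 2 * k)" for i j
      using matrix_entries_even[OF \<open>tight 0 \<Lambda>\<close>, of n i j] by (auto elim!: evenE)
    moreover have "M n \<in> GL2_Z" using assms(1) \<open>n \<ge> 2\<close> by simp
    ultimately show "M n \<in> GL2_2Z" by (simp add: GL2_2Z_def)
  qed
qed

end
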